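(* Suppose that there exists $c\in(a,b)$ such that $p$ is sign-definite a.e. on $(c,b)$ (i.e. $p>0$ a.e. or $p<0$ a.e. on $(c,b)$), and that $\tau-\lambda$ is non-oscillatory at $b$ for some $\lambda\in\mathbb R$. If $$\int^b\left|\frac{r(x)}{p(x)}\right|^{1/2}dx=\infty,$$ then $\tau$ is in the limit-point case at $b$. An analogous result holds at $a$.
   Context: Setting. $(a,b)\subseteq\mathbb R$ is an open interval (possibly unbounded); $p,q,r,s$ are Lebesgue measurable and real-valued a.e. on $(a,b)$, with $p^{-1},q,r,s\in L^1_{\mathrm{loc}}((a,b);dx)$, $r>0$ and $p\neq0$ a.e. For $f\in AC_{\mathrm{loc}}((a,b))$ put $f^{[1]}=p(f'+sf)$, $\mathfrak D_\tau=\{f\in AC_{\mathrm{loc}}((a,b)) : f^{[1]}\in AC_{\mathrm{loc}}((a,b))\}$, and $\tau f=\frac1r\big(-(f^{[1]})'+sf^{[1]}+qf\big)$ for $f\in\mathfrak D_\tau$; solutions of $(\tau-z)u=0$ are elements of $\mathfrak D_\tau$. $\tau-\lambda$ is called oscillatory at $b$ if some nontrivial real-valued solution of $(\tau-\lambda)u=0$ has infinitely many zeros accumulating at $b$; otherwise non-oscillatory at $b$ (similarly at $a$). $\tau$ is in the limit-point case at $b$ if for each $z\in\mathbb C$ there is a solution of $(\tau-z)u=0$ which does not lie in $L^2((c',b);r(x)dx)$ for some $c'\in(a,b)$ (similarly at $a$). The notation $\int^b$ denotes integration over a (left) neighborhood of $b$. *)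

theory Defs
  imports "HOL-Analysis.Analysis"
begin

text \<open>
  The interval \<open>(a, b)\<close> with extended real endpoints is \<^term>\<open>einterval a b\<close>. Functions on it are
  total functions on the reals; their values outside \<^term>\<open>einterval a b\<close> are never used.
\<close>

definition L1_loc :: "ereal \<Rightarrow> ereal \<Rightarrow> (real \<Rightarrow> real) \<Rightarrow> bool" where
  "L1_loc a b f \<longleftrightarrow>
     (\<forall>c d. {c..d} \<subseteq> einterval a b \<longrightarrow> set_integrable lebesgue {c..d} f)"

text \<open>
  The usual epsilon-delta definition of absolute continuity; a finite family of nonoverlapping
  open subintervals \<open>(x, y)\<close> of \<open>[c, d]\<close> is given as the set \<open>I\<close> of the pairs \<open>(x, y)\<close>.
\<close>

definition AC_on :: "real \<Rightarrow> real \<Rightarrow> (real \<Rightarrow> complex) \<Rightarrow> bool" where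
  "AC_on c d f \<longleftrightarrow>
     (\<forall>\<epsilon>>0. \<exists>\<delta>>0. \<forall>I :: (real \<times> real) set.
        finite I \<longrightarrow> (\<forall>(x, y)\<in>I. c \<le> x \<and> x < y \<and> y \<le> d) \<longrightarrow>
        pairwise (\<lambda>(x, y) (x', y'). {x<..<y} \<inter> {x'<..<y'} = {}) I \<longrightarrow>
        (\<Sum>(x, y)\<in>I. y - x) < \<delta> \<longrightarrow> (\<Sum>(x, y)\<in>I. cmod (f y - f x)) < \<epsilon>)"

definition AC_loc :: "ereal \<Rightarrow> ereal \<Rightarrow> (real \<Rightarrow> complex) \<Rightarrow> bool" where
  "AC_loc a b f \<longleftrightarrow> (\<forall>c d. c \<le> d \<longrightarrow> {c..d} \<subseteq> einterval a b \<longrightarrow> AC_on c d f)"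

definition ae_deriv :: "ereal \<Rightarrow> ereal \<Rightarrow> (real \<Rightarrow> complex) \<Rightarrow> (real \<Rightarrow> complex) \<Rightarrow> bool" where
  "ae_deriv a b f f' \<longleftrightarrow>
     (AE x\<in>einterval a b in lebesgue. (f has_vector_derivative f' x) (at x))"

text \<open>
  \<open>quasi_deriv a b p s f f1\<close> says that \<open>f \<in> AC_loc\<close> and that \<open>f1 \<in> AC_loc\<close> is the quasi-derivative
  \<open>p (f' + s f)\<close>. As \<open>f'\<close> exists only almost everywhere, \<open>p (f' + s f) \<in> AC_loc\<close> means that this
  function has a representative in \<open>AC_loc\<close>, which by continuity is unique on \<open>(a, b)\<close>.
  The domain of \<open>\<tau>\<close> consists of the \<open>f\<close> for which such an \<open>f1\<close> exists.
\<close>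

definition quasi_deriv ::
  "ereal \<Rightarrow> ereal \<Rightarrow> (real \<Rightarrow> real) \<Rightarrow> (real \<Rightarrow> real) \<Rightarrow> (real \<Rightarrow> complex) \<Rightarrow> (real \<Rightarrow> complex) \<Rightarrow> bool"
where
  "quasi_deriv a b p s f f1 \<longleftrightarrow>
     AC_loc a b f \<and> AC_loc a b f1 \<and>
     (\<exists>f'. ae_deriv a b f f' \<and>
       (AE x\<in>einterval a b in lebesgue.
          f1 x = of_real (p x) * (f' x + of_real (s x) * f x)))"

definition sl_domain ::
  "ereal \<Rightarrow> ereal \<Rightarrow> (real \<Rightarrow> real) \<Rightarrow> (real \<Rightarrow> real) \<Rightarrow> (real \<Rightarrow> complex) set"
where
  "sl_domain a b p s = {f. \<exists>f1. quasi_deriv a b p s f f1}"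

text \<open>
  \<open>has_tau a b p q r s f g\<close>: \<open>\<tau> f = g\<close> almost everywhere on \<open>(a, b)\<close>.
\<close>

definition has_tau ::
  "ereal \<Rightarrow> ereal \<Rightarrow> (real \<Rightarrow> real) \<Rightarrow> (real \<Rightarrow> real) \<Rightarrow> (real \<Rightarrow> real) \<Rightarrow> (real \<Rightarrow> real) \<Rightarrow>
   (real \<Rightarrow> complex) \<Rightarrow> (real \<Rightarrow> complex) \<Rightarrow> bool"
where
  "has_tau a b p q r s f g \<longleftrightarrow>
     (\<exists>f1 f1'. quasi_deriv a b p s f f1 \<and> ae_deriv a b f1 f1' \<and>
       (AE x\<in>einterval a b in lebesgue.
          g x = 1 / of_real (r x) *
                (- f1' x + of_real (s x) * f1 x + of_real (q x) * f x)))"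

definition sl_solution ::
  "ereal \<Rightarrow> ereal \<Rightarrow> (real \<Rightarrow> real) \<Rightarrow> (real \<Rightarrow> real) \<Rightarrow> (real \<Rightarrow> real) \<Rightarrow> (real \<Rightarrow> real) \<Rightarrow>
   complex \<Rightarrow> (real \<Rightarrow> complex) \<Rightarrow> bool"
where
  "sl_solution a b p q r s z u \<longleftrightarrow>
     u \<in> sl_domain a b p s \<and> has_tau a b p q r s u (\<lambda>x. z * u x)"

definition nontrivial_real_solution ::
  "ereal \<Rightarrow> ereal \<Rightarrow> (real \<Rightarrow> real) \<Rightarrow> (real \<Rightarrow> real) \<Rightarrow> (real \<Rightarrow> real) \<Rightarrow> (real \<Rightarrow> real) \<Rightarrow>
   real \<Rightarrow> (real \<Rightarrow> complex) \<Rightarrow> bool"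
where
  "nontrivial_real_solution a b p q r s \<mu> u \<longleftrightarrow>
     sl_solution a b p q r s (of_real \<mu>) u \<and>
     (\<forall>x\<in>einterval a b. u x \<in> \<real>) \<and> (\<exists>x\<in>einterval a b. u x \<noteq> 0)"

definition oscillatory_at_right_end ::
  "ereal \<Rightarrow> ereal \<Rightarrow> (real \<Rightarrow> real) \<Rightarrow> (real \<Rightarrow> real) \<Rightarrow> (real \<Rightarrow> real) \<Rightarrow> (real \<Rightarrow> real) \<Rightarrow> real \<Rightarrow> bool"
where
  "oscillatory_at_right_end a b p q r s \<mu> \<longleftrightarrow>
     (\<exists>u. nontrivial_real_solution a b p q r s \<mu> u \<and>
          (\<forall>c\<in>einterval a b. infinite {x \<in> einterval (ereal c) b. u x = 0}))"

definition oscillatory_at_left_end ::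
  "ereal \<Rightarrow> ereal \<Rightarrow> (real \<Rightarrow> real) \<Rightarrow> (real \<Rightarrow> real) \<Rightarrow> (real \<Rightarrow> real) \<Rightarrow> (real \<Rightarrow> real) \<Rightarrow> real \<Rightarrow> bool"
where
  "oscillatory_at_left_end a b p q r s \<mu> \<longleftrightarrow>
     (\<exists>u. nontrivial_real_solution a b p q r s \<mu> u \<and>
          (\<forall>c\<in>einterval a b. infinite {x \<in> einterval a (ereal c). u x = 0}))"

definition weighted_L2 :: "(real \<Rightarrow> real) \<Rightarrow> real set \<Rightarrow> (real \<Rightarrow> complex) \<Rightarrow> bool" where
  "weighted_L2 r J u \<longleftrightarrow>
     set_borel_measurable lebesgue J u \<and>
     set_integrable lebesgue J (\<lambda>x. (cmod (u x))\<^sup>2 * r x)"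

definition limit_point_at_right_end ::
  "ereal \<Rightarrow> ereal \<Rightarrow> (real \<Rightarrow> real) \<Rightarrow> (real \<Rightarrow> real) \<Rightarrow> (real \<Rightarrow> real) \<Rightarrow> (real \<Rightarrow> real) \<Rightarrow> bool"
where
  "limit_point_at_right_end a b p q r s \<longleftrightarrow>
     (\<forall>z. \<exists>u. sl_solution a b p q r s z u \<and>
          (\<exists>c\<in>einterval a b. \<not> weighted_L2 r (einterval (ereal c) b) u))"

definition limit_point_at_left_end ::
  "ereal \<Rightarrow> ereal \<Rightarrow> (real \<Rightarrow> real) \<Rightarrow> (real \<Rightarrow> real) \<Rightarrow> (real \<Rightarrow> real) \<Rightarrow> (real \<Rightarrow> real) \<Rightarrow> bool"
where
  "limit_point_at_left_end a b p q r s \<longleftrightarrow>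
     (\<forall>z. \<exists>u. sl_solution a b p q r s z u \<and>
          (\<exists>c\<in>einterval a b. \<not> weighted_L2 r (einterval a (ereal c)) u))"

definition sign_definite_on :: "(real \<Rightarrow> real) \<Rightarrow> real set \<Rightarrow> bool" where
  "sign_definite_on p J \<longleftrightarrow>
     (AE x\<in>J in lebesgue. p x > 0) \<or> (AE x\<in>J in lebesgue. p x < 0)"

definition sqrt_ratio_integral_diverges ::
  "(real \<Rightarrow> real) \<Rightarrow> (real \<Rightarrow> real) \<Rightarrow> real set \<Rightarrow> bool"
where
  "sqrt_ratio_integral_diverges p r J \<longleftrightarrow>
     (\<integral>\<^sup>+x\<in>J. ennreal (sqrt \<bar>r x / p x\<bar>) \<partial>lebesgue) = \<infinity>"

definition sl_coefficients ::
  "ereal \<Rightarrow> ereal \<Rightarrow> (real \<Rightarrow> real) \<Rightarrow> (real \<Rightarrow> real) \<Rightarrow> (real \<Rightarrow> real) \<Rightarrow> (real \<Rightarrow> real) \<Rightarrow> bool"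
where
  "sl_coefficients a b p q r s \<longleftrightarrow>
     set_borel_measurable lebesgue (einterval a b) p \<and>
     set_borel_measurable lebesgue (einterval a b) q \<and>
     set_borel_measurable lebesgue (einterval a b) r \<and>
     set_borel_measurable lebesgue (einterval a b) s \<and>
     L1_loc a b (\<lambda>x. 1 / p x) \<and> L1_loc a b q \<and> L1_loc a b r \<and> L1_loc a b s \<and>
     (AE x\<in>einterval a b in lebesgue. r x > 0) \<and>
     (AE x\<in>einterval a b in lebesgue. p x \<noteq> 0)"

end

theory Submission
  imports Defs
begin

text \<open>
  Suppose that for some \<open>z\<close> all solutions are square integrable near the endpoint. By variation of
  constants the same holds for the real solutions at \<open>\<lambda>\<close>. Take two of them, \<open>y\<close> and \<open>w\<close>, with
  Wronskian \<open>1\<close>, and put \<open>\<rho> = y\<^sup>2 + w\<^sup>2\<close>. Since \<open>\<tau> - \<lambda>\<close> is non-oscillatory, \<open>y\<close> has no zero near the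
  endpoint, and there \<open>(arctan (w / y))' = 1 / (p \<rho>)\<close> has constant sign, so \<open>1 / (p \<rho>)\<close> is
  integrable. As \<open>r \<rho>\<close> is integrable too, \<open>2 \<bar>r / p\<bar>\<^sup>1\<^sup>/\<^sup>2 \<le> r \<rho> + 1 / (\<bar>p\<bar> \<rho>)\<close> contradicts the
  divergence of the integral.

  The contradiction only involves solutions that are constructed from initial values, so one never
  needs that an element of the domain of \<open>\<tau>\<close> satisfies an integral equation: solutions are handled as
  antiderivatives, which are absolutely continuous and have the right derivative almost everywhere.
\<close>

section \<open>Antiderivatives of locally integrable functions\<close>

text \<open>The obstacle is regularity: with coefficients that are merely locally integrable,
  solutions are not C^1, so product, quotient and chain rule have to be available for primitives of
  L1 functions. They are proved for increments over intervals, using continuity of the primitives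
  and a bisection argument. Differentiation almost everywhere enters only when a constructed
  solution is matched with the definition of a solution. The transfer between spectral parameters
  cannot be avoided: denying the limit-point property yields a single z, possibly non-real, whereas
  non-oscillation is known at a real parameter unrelated to z. Hence z is handled with complex
  solutions and \<lambda> with real ones, and the first-order system is stated for both scalar
  fields. Non-oscillation is applied to \<open>y\<close> alone; zeros of \<open>w\<close> do no
  harm, since only \<open>y\<close> stands in the denominator of the angle. The estimate uses
  nothing about which end of the interval is approached, so one lemma about a subinterval serves
  both endpoints.\<close>

definition loc_int :: "real set \<Rightarrow> (real \<Rightarrow> 'a::euclidean_space) \<Rightarrow> bool" where
  "loc_int I f \<longleftrightarrow> (\<forall>x y. {x..y} \<subseteq> I \<longrightarrow> f absolutely_integrable_on {x..y})"

text \<open>On an interval this is local absolute continuity of \<open>F\<close> with derivative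
  \<open>f\<close> almost everywhere, phrased without derivatives. The clause \<open>loc_int\<close>
  excludes functions that are gauge integrable but not Lebesgue integrable, whose products with
  continuous functions could fail to be integrable.\<close>

definition antideriv ::
  "real set \<Rightarrow> (real \<Rightarrow> 'a::euclidean_space) \<Rightarrow> (real \<Rightarrow> 'a) \<Rightarrow> bool" where
  "antideriv I f F \<longleftrightarrow> loc_int I f \<and>
     (\<forall>x y. x \<le> y \<longrightarrow> {x..y} \<subseteq> I \<longrightarrow> (f has_integral (F y - F x)) {x..y})"

lemma loc_int_D: "loc_int I f \<Longrightarrow> {x..y} \<subseteq> I \<Longrightarrow> f absolutely_integrable_on {x..y}"
  by (simp add: loc_int_def)

lemma loc_int_integrable: "loc_int I f \<Longrightarrow> {x..y} \<subseteq> I \<Longrightarrow> f integrable_on {x..y}"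
  by (simp add: loc_int_def set_lebesgue_integral_eq_integral(1))

lemma loc_int_subset: "loc_int I f \<Longrightarrow> J \<subseteq> I \<Longrightarrow> loc_int J f"
  by (auto simp: loc_int_def)

lemma loc_int_norm: "loc_int I f \<Longrightarrow> loc_int I (\<lambda>t. norm (f t))"
  by (auto simp: loc_int_def intro: absolutely_integrable_norm[unfolded o_def])

lemma loc_int_add: "loc_int I f \<Longrightarrow> loc_int I g \<Longrightarrow> loc_int I (\<lambda>t. f t + g t)"
  by (auto simp: loc_int_def)

lemma loc_int_linear:
  assumes "loc_int I f" "bounded_linear h"
  shows "loc_int I (\<lambda>t. h (f t))"
  using assms by (auto simp: loc_int_def intro: absolutely_integrable_linear[unfolded o_def])

text \<open>On each compact subinterval the continuous factor is bounded and measurable.\<close>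

lemma loc_int_bilinear:
  fixes h :: "'a::euclidean_space \<Rightarrow> 'b::euclidean_space \<Rightarrow> 'c::euclidean_space"
  assumes h: "bounded_bilinear h" and f: "loc_int I f" and G: "continuous_on I G"
  shows "loc_int I (\<lambda>t. h (f t) (G t))"
  unfolding loc_int_def
proof (intro allI impI)
  fix x y :: real
  assume xy: "{x..y} \<subseteq> I"
  interpret h: bounded_bilinear h by (rule h)
  have GI: "continuous_on {x..y} G"
    using G xy continuous_on_subset by blast
  have "bilinear (\<lambda>b a. h a b)"
    unfolding bilinear_def
    by (intro conjI allI bounded_linear.linear h.bounded_linear_left h.bounded_linear_right)
  then show "(\<lambda>t. h (f t) (G t)) absolutely_integrable_on {x..y}"
  proof (rule absolutely_integrable_bounded_measurable_product)
    show "G \<in> borel_measurable (lebesgue_on {x..y})"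
      using GI by (simp add: continuous_imp_measurable_on_sets_lebesgue)
    show "bounded (G ` {x..y})"
      using GI by (intro compact_imp_bounded compact_continuous_image) auto
    show "f absolutely_integrable_on {x..y}"
      using f xy by (rule loc_int_D)
  qed auto
qed

lemma antideriv_loc_int: "antideriv I f F \<Longrightarrow> loc_int I f"
  by (simp add: antideriv_def)

lemma antideriv_has_integral:
  "antideriv I f F \<Longrightarrow> x \<le> y \<Longrightarrow> {x..y} \<subseteq> I \<Longrightarrow> (f has_integral (F y - F x)) {x..y}"
  by (simp add: antideriv_def)

lemma antideriv_subset: "antideriv I f F \<Longrightarrow> J \<subseteq> I \<Longrightarrow> antideriv J f F"
  unfolding antideriv_def by (meson loc_int_subset order_trans)

lemma antideriv_cong:
  assumes "antideriv I f F" "\<And>t. t \<in> I \<Longrightarrow> f t = g t" "\<And>t. t \<in> I \<Longrightarrow> F t = G t"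
  shows "antideriv I g G"
  unfolding antideriv_def loc_int_def
proof (intro conjI allI impI)
  fix x y :: real assume xy: "{x..y} \<subseteq> I"
  show "g absolutely_integrable_on {x..y}"
  proof (rule absolutely_integrable_spike[OF _ negligible_empty])
    show "f absolutely_integrable_on {x..y}"
      using assms(1) xy by (intro loc_int_D[OF antideriv_loc_int])
  qed (use assms(2) xy in auto)
next
  fix x y :: real assume le: "x \<le> y" and xy: "{x..y} \<subseteq> I"
  have "(f has_integral (G y - G x)) {x..y}"
    using antideriv_has_integral[OF assms(1) le xy] assms(3) le xy by (simp add: subset_iff)
  with assms(2) xy show "(g has_integral (G y - G x)) {x..y}"
    by (auto intro: has_integral_eq[rotated])
qed

lemma antideriv_linear:
  assumes "antideriv I f F" "bounded_linear h"
  shows "antideriv I (\<lambda>t. h (f t)) (\<lambda>t. h (F t))"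
  unfolding antideriv_def
proof (intro conjI allI impI)
  show "loc_int I (\<lambda>t. h (f t))"
    using assms antideriv_loc_int loc_int_linear by blast
  fix x y assume "x \<le> y" "{x..y} \<subseteq> I"
  from has_integral_linear[OF antideriv_has_integral[OF assms(1) this] assms(2)]
  show "((\<lambda>t. h (f t)) has_integral h (F y) - h (F x)) {x..y}"
    using assms(2) by (simp add: o_def linear_diff bounded_linear.linear)
qed

lemma antideriv_add:
  assumes "antideriv I f F" "antideriv I g G"
  shows "antideriv I (\<lambda>t. f t + g t) (\<lambda>t. F t + G t)"
  unfolding antideriv_def
proof (intro conjI allI impI)
  show "loc_int I (\<lambda>t. f t + g t)"
    using assms antideriv_loc_int loc_int_add by blast
  fix x y assume "x \<le> y" "{x..y} \<subseteq> I"
  from has_integral_add[OF assms[THEN antideriv_has_integral, OF this]]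
  show "((\<lambda>t. f t + g t) has_integral F y + G y - (F x + G x)) {x..y}"
    by (simp add: algebra_simps)
qed

lemma antideriv_diff:
  assumes "antideriv I f F" "antideriv I g G"
  shows "antideriv I (\<lambda>t. f t - g t) (\<lambda>t. F t - G t)"
  using antideriv_add[OF assms(1) antideriv_linear[OF assms(2) bounded_linear_minus[OF bounded_linear_ident]]]
  by simp

lemma antideriv_const: "antideriv I (\<lambda>t. 0) (\<lambda>t. c)"
  by (simp add: antideriv_def loc_int_def)

lemma is_interval_Icc_subset:
  fixes x y :: real
  shows "is_interval I \<Longrightarrow> x \<in> I \<Longrightarrow> y \<in> I \<Longrightarrow> {x..y} \<subseteq> I"
  by (meson atLeastAtMost_iff mem_is_interval_1_I subsetI)

text \<open>\<open>x\<close> and \<open>y\<close> may come in either order, so the bound can be used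
  on both sides of an initial point; the absolute value absorbs the orientation.\<close>

lemma antideriv_norm_bound:
  assumes "antideriv I f F" "antideriv I g G" and "is_interval I" "x \<in> I" "y \<in> I"
    and b: "\<And>t. t \<in> I \<Longrightarrow> norm (f t) \<le> g t"
  shows "norm (F y - F x) \<le> \<bar>G y - G x\<bar>"
proof -
  have *: "norm (F v - F u) \<le> G v - G u" if "u \<le> v" "u \<in> I" "v \<in> I" for u v
  proof -
    have sub: "{u..v} \<subseteq> I"
      using assms that by (intro is_interval_Icc_subset)
    note i = antideriv_has_integral[OF assms(1) that(1) sub] antideriv_has_integral[OF assms(2) that(1) sub]
    have "norm (integral {u..v} f) \<le> integral {u..v} g"
      using i b sub by (intro integral_norm_bound_integral) (auto simp: has_integral_iff)
    then show ?thesis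
      using i by (simp add: has_integral_iff)
  qed
  show ?thesis
    using *[of x y] *[of y x] assms(4,5) by (cases "x \<le> y") (auto simp: norm_minus_commute)
qed

lemma antideriv_mono:
  assumes "antideriv I f F" "antideriv I g G" "is_interval I" "x \<in> I" "y \<in> I" "x \<le> y"
    and b: "\<And>t. t \<in> I \<Longrightarrow> f t \<le> (g t :: real)"
  shows "F y - F x \<le> G y - G x"
  using assms is_interval_Icc_subset[OF assms(3-5)]
  by (intro has_integral_le[OF antideriv_has_integral[OF assms(1)] antideriv_has_integral[OF assms(2)]]) auto

lemma continuous_on_open_from_Icc:
  fixes F :: "real \<Rightarrow> 'a::topological_space"
  assumes "open I" and c: "\<And>x y. {x..y} \<subseteq> I \<Longrightarrow> continuous_on {x..y} F"
  shows "continuous_on I F"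
proof (rule continuous_at_imp_continuous_on, rule ballI)
  fix t assume "t \<in> I"
  then obtain e where e: "e > 0" "cball t e \<subseteq> I"
    using assms(1) open_contains_cball by blast
  then have "continuous_on {t - e..t + e} F"
    by (intro c) (simp add: cball_eq_atLeastAtMost)
  then show "continuous (at t) F"
    using e by (intro continuous_on_interior[of "{t - e..t + e}"]) auto
qed

lemma antideriv_continuous_on:
  assumes "antideriv I f F" "open I"
  shows "continuous_on I F"
proof (rule continuous_on_open_from_Icc[OF assms(2)])
  fix u v assume sub: "{u..v} \<subseteq> I"
  have "continuous_on {u..v} (\<lambda>x. F u + integral {u..x} f)"
    using loc_int_integrable[OF antideriv_loc_int[OF assms(1)] sub]
    by (intro continuous_intros indefinite_integral_continuous_1)
  moreover have "F u + integral {u..x} f = F x" if "x \<in> {u..v}" for x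
    using antideriv_has_integral[OF assms(1), of u x] that sub
    by (auto simp: has_integral_iff subset_iff)
  ultimately show "continuous_on {u..v} F"
    by (rule continuous_on_eq)
qed

text \<open>
  An additive interval function that is locally \<open>o(\<integral> k)\<close> vanishes; hence it is enough to match the
  increments of \<open>P\<close> up to such errors, and no differentiability of \<open>P\<close> is needed.
\<close>

lemma has_integral_from_local_increments:
  fixes d :: "real \<Rightarrow> 'a::euclidean_space"
  assumes "x \<le> y" and d: "d integrable_on {x..y}" and k: "k integrable_on {x..y}"
    and loc: "\<And>\<epsilon> t. \<epsilon> > 0 \<Longrightarrow> x \<le> t \<Longrightarrow> t \<le> y \<Longrightarrow>
       \<exists>\<delta>>0. \<forall>u v. x \<le> u \<longrightarrow> u \<le> t \<longrightarrow> t \<le> v \<longrightarrow> v \<le> y \<longrightarrow> v - u < \<delta> \<longrightarrow>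
          norm (P v - P u - integral {u..v} d) \<le> \<epsilon> * integral {u..v} k"
  shows "(d has_integral (P y - P x)) {x..y}"
proof -
  have bound: "norm (P y - P x - integral {x..y} d) \<le> \<epsilon> * integral {x..y} k" if "\<epsilon> > 0" for \<epsilon>
  proof -
    \<comment> \<open>The bisection principle tests all intervals around a point, including those
      that leave \<open>{x..y}\<close>; the premise makes \<open>B\<close> vacuous there.\<close>
    define B where "B u v \<longleftrightarrow> (x \<le> u \<and> v \<le> y \<longrightarrow>
      norm (P v - P u - integral {u..v} d) \<le> \<epsilon> * integral {u..v} k)" for u v
    have "B x y"
    proof (rule Bolzano)
      show "x \<le> y" by fact
    next
      fix u v w assume uvw: "B u v" "B v w" "u \<le> v" "v \<le> w"
      show "B u w"
        unfolding B_def
      proof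
        assume xy: "x \<le> u \<and> w \<le> y"
        have sub: "d integrable_on {u..w}" "k integrable_on {u..w}"
          using d k xy by (auto intro: integrable_subinterval_real)
        note c = Henstock_Kurzweil_Integration.integral_combine[OF uvw(3,4), symmetric]
        have "P w - P u - integral {u..w} d =
            (P v - P u - integral {u..v} d) + (P w - P v - integral {v..w} d)"
          using c[OF sub(1)] by simp
        then have "norm (P w - P u - integral {u..w} d) \<le>
            norm (P v - P u - integral {u..v} d) + norm (P w - P v - integral {v..w} d)"
          using norm_triangle_ineq by metis
        also have "\<dots> \<le> \<epsilon> * integral {u..v} k + \<epsilon> * integral {v..w} k"
          using uvw xy unfolding B_def by (intro add_mono) auto
        also have "\<dots> = \<epsilon> * integral {u..w} k"
          using c[OF sub(2)] by (simp add: algebra_simps)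
        finally show "norm (P w - P u - integral {u..w} d) \<le> \<epsilon> * integral {u..w} k" .
      qed
    next
      fix t assume "x \<le> t" "t \<le> y"
      from loc[OF that this] obtain \<delta> where "\<delta> > 0"
        and \<delta>: "\<And>u v. x \<le> u \<Longrightarrow> u \<le> t \<Longrightarrow> t \<le> v \<Longrightarrow> v \<le> y \<Longrightarrow> v - u < \<delta> \<Longrightarrow>
          norm (P v - P u - integral {u..v} d) \<le> \<epsilon> * integral {u..v} k"
        by blast
      then show "\<exists>\<delta>>0. \<forall>u v. u \<le> t \<and> t \<le> v \<and> v - u < \<delta> \<longrightarrow> B u v"
        unfolding B_def by (intro exI[of _ \<delta>]) auto
    qed
    then show ?thesis
      by (simp add: B_def)
  qed
  have "norm (P y - P x - integral {x..y} d) \<le> 0"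
  proof (rule field_le_epsilon)
    fix e :: real assume "e > 0"
    define c where "c = \<bar>integral {x..y} k\<bar> + 1"
    have "c > 0" unfolding c_def by linarith
    have "norm (P y - P x - integral {x..y} d) \<le> (e / c) * integral {x..y} k"
      using \<open>e > 0\<close> \<open>c > 0\<close> by (intro bound) auto
    also have "\<dots> \<le> (e / c) * c"
      using \<open>e > 0\<close> \<open>c > 0\<close> by (intro mult_left_mono) (auto simp: c_def)
    finally show "norm (P y - P x - integral {x..y} d) \<le> 0 + e"
      using \<open>c > 0\<close> by simp
  qed
  then show ?thesis
    using d by (simp add: has_integral_iff)
qed

lemma antideriv_bilinear:
  fixes h :: "'a::euclidean_space \<Rightarrow> 'b::euclidean_space \<Rightarrow> 'c::euclidean_space"
  assumes h: "bounded_bilinear h" and F: "antideriv I f F" and G: "antideriv I g G" and I: "open I"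
  shows "antideriv I (\<lambda>t. h (f t) (G t) + h (F t) (g t)) (\<lambda>t. h (F t) (G t))"
proof -
  interpret h: bounded_bilinear h by (rule h)
  have cF: "continuous_on I F" and cG: "continuous_on I G"
    using F G I by (auto intro: antideriv_continuous_on)
  have li1: "loc_int I (\<lambda>t. h (f t) (G t))"
    using loc_int_bilinear[OF h antideriv_loc_int[OF F] cG] .
  have li2: "loc_int I (\<lambda>t. h (F t) (g t))"
    using loc_int_bilinear[OF h.flip antideriv_loc_int[OF G] cF] .
  have li: "loc_int I (\<lambda>t. h (f t) (G t) + h (F t) (g t))"
    using li1 li2 by (rule loc_int_add)
  have lk: "loc_int I (\<lambda>t. norm (f t) + norm (g t))"
    using F G by (intro loc_int_add loc_int_norm antideriv_loc_int)
  obtain B where B: "B > 0" "\<And>a b. norm (h a b) \<le> norm a * norm b * B"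
    using h.pos_bounded by blast
  show ?thesis
    unfolding antideriv_def
  proof (intro conjI li allI impI)
    fix x y assume xy: "x \<le> y" and sub: "{x..y} \<subseteq> I"
    show "((\<lambda>t. h (f t) (G t) + h (F t) (g t)) has_integral h (F y) (G y) - h (F x) (G x)) {x..y}"
    proof (rule has_integral_from_local_increments[OF xy loc_int_integrable[OF li sub] loc_int_integrable[OF lk sub]])
      fix \<epsilon> t :: real assume "\<epsilon> > 0" "x \<le> t" "t \<le> y"
      then have tI: "t \<in> I" using sub by auto
      \<comment> \<open>Comparison through the point \<open>t\<close> doubles \<omega>, and
        \<open>B\<close> bounds \<open>h\<close>; the choice makes 2 \<omega> B equal to
        \<epsilon>.\<close>
      define \<omega> where "\<omega> = \<epsilon> / (2 * B)"
      have "\<omega> > 0" using \<open>\<epsilon> > 0\<close> B by (simp add: \<omega>_def)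
      obtain d1 where d1: "d1 > 0" "\<And>s. s \<in> I \<Longrightarrow> dist s t < d1 \<Longrightarrow> dist (F s) (F t) < \<omega>"
        using cF tI \<open>\<omega> > 0\<close> unfolding continuous_on_iff by blast
      obtain d2 where d2: "d2 > 0" "\<And>s. s \<in> I \<Longrightarrow> dist s t < d2 \<Longrightarrow> dist (G s) (G t) < \<omega>"
        using cG tI \<open>\<omega> > 0\<close> unfolding continuous_on_iff by blast
      show "\<exists>\<delta>>0. \<forall>u v. x \<le> u \<longrightarrow> u \<le> t \<longrightarrow> t \<le> v \<longrightarrow> v \<le> y \<longrightarrow> v - u < \<delta> \<longrightarrow>
          norm (h (F v) (G v) - h (F u) (G u) - integral {u..v} (\<lambda>t. h (f t) (G t) + h (F t) (g t)))
          \<le> \<epsilon> * integral {u..v} (\<lambda>t. norm (f t) + norm (g t))"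
      proof (intro exI[of _ "min d1 d2"] conjI allI impI)
        show "min d1 d2 > 0" using d1 d2 by simp
        fix u v assume uv: "x \<le> u" "u \<le> t" "t \<le> v" "v \<le> y" "v - u < min d1 d2"
        then have suv: "{u..v} \<subseteq> I" and uv': "u \<le> v" using sub by auto
        have close: "norm (G v - G s) \<le> 2 * \<omega> \<and> norm (F u - F s) \<le> 2 * \<omega>" if "s \<in> {u..v}" for s
        proof -
          have "dist (G v) (G t) < \<omega>" "dist (G s) (G t) < \<omega>"
            using uv that suv by (auto intro!: d2(2) simp: dist_real_def)
          moreover have "dist (F u) (F t) < \<omega>" "dist (F s) (F t) < \<omega>"
            using uv that suv by (auto intro!: d1(2) simp: dist_real_def)
          ultimately have "dist (G v) (G s) < 2 * \<omega>" "dist (F u) (F s) < 2 * \<omega>"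
            using dist_triangle_half_l[of _ _ "2 * \<omega>"] by auto
          then show ?thesis by (simp add: dist_norm)
        qed
        have i1: "((\<lambda>s. h (f s) (G v)) has_integral h (F v - F u) (G v)) {u..v}"
          using has_integral_linear[OF antideriv_has_integral[OF F uv' suv] h.bounded_linear_left]
          by (simp add: o_def)
        have i2: "((\<lambda>s. h (F u) (g s)) has_integral h (F u) (G v - G u)) {u..v}"
          using has_integral_linear[OF antideriv_has_integral[OF G uv' suv] h.bounded_linear_right]
          by (simp add: o_def)
        note i3 = has_integral_diff[OF has_integral_add[OF i1 i2] integrable_integral[OF loc_int_integrable[OF li suv]]]
        have "h (F v - F u) (G v) + h (F u) (G v - G u) = h (F v) (G v) - h (F u) (G u)"
          by (simp add: h.diff_left h.diff_right)
        with i3 have i4: "((\<lambda>s. h (f s) (G v) + h (F u) (g s) - (h (f s) (G s) + h (F s) (g s)))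
          has_integral (h (F v) (G v) - h (F u) (G u) - integral {u..v} (\<lambda>t. h (f t) (G t) + h (F t) (g t)))) {u..v}"
          by simp
        have "norm (integral {u..v} (\<lambda>s. h (f s) (G v) + h (F u) (g s) - (h (f s) (G s) + h (F s) (g s))))
          \<le> integral {u..v} (\<lambda>s. \<epsilon> * (norm (f s) + norm (g s)))"
        proof (rule integral_norm_bound_integral)
          show "(\<lambda>s. \<epsilon> * (norm (f s) + norm (g s))) integrable_on {u..v}"
            using integrable_cmul[OF loc_int_integrable[OF lk suv]] by simp
          fix s assume s: "s \<in> {u..v}"
          have "h (f s) (G v) + h (F u) (g s) - (h (f s) (G s) + h (F s) (g s)) =
             h (f s) (G v - G s) + h (F u - F s) (g s)"
            by (simp add: h.diff_left h.diff_right)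
          also have "norm \<dots> \<le> norm (f s) * norm (G v - G s) * B + norm (F u - F s) * norm (g s) * B"
            by (intro norm_triangle_le add_mono B)
          also have "\<dots> \<le> norm (f s) * (2 * \<omega>) * B + (2 * \<omega>) * norm (g s) * B"
            using close[OF s] B(1) by (intro add_mono mult_right_mono mult_left_mono) auto
          also have "\<dots> = \<epsilon> * (norm (f s) + norm (g s))"
            using B(1) by (simp add: \<omega>_def field_simps)
          finally show "norm (h (f s) (G v) + h (F u) (g s) - (h (f s) (G s) + h (F s) (g s)))
            \<le> \<epsilon> * (norm (f s) + norm (g s))" .
        qed (use i4 in blast)
        then show "norm (h (F v) (G v) - h (F u) (G u) - integral {u..v} (\<lambda>t. h (f t) (G t) + h (F t) (g t)))
          \<le> \<epsilon> * integral {u..v} (\<lambda>t. norm (f t) + norm (g t))"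
          using i4 by (simp add: has_integral_iff)
      qed
    qed
  qed
qed

text \<open>The mean value theorem for \<phi> writes its increment as (F v - F u) \<phi>'(F \<tau>),
  and \<phi>'(F \<tau>) is close to \<phi>'(F s) on short intervals. Differentiability of \<phi> is
  required only at values taken by \<open>F\<close>, so \<phi> may be \<open>inverse\<close> when
  \<open>F\<close> has no zeros.\<close>

lemma antideriv_chain:
  fixes F :: "real \<Rightarrow> real"
  assumes F: "antideriv I f F" and I: "open I"
    and \<phi>: "\<And>t. t \<in> I \<Longrightarrow> (\<phi> has_real_derivative \<phi>' (F t)) (at (F t))"
    and c\<phi>: "continuous_on I (\<lambda>t. \<phi>' (F t))"
  shows "antideriv I (\<lambda>t. f t * \<phi>' (F t)) (\<lambda>t. \<phi> (F t))"
proof -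
  have cF: "continuous_on I F"
    using F I by (rule antideriv_continuous_on)
  have li: "loc_int I (\<lambda>t. f t * \<phi>' (F t))"
    using loc_int_bilinear[OF bounded_bilinear_mult antideriv_loc_int[OF F] c\<phi>] .
  have lk: "loc_int I (\<lambda>t. norm (f t))"
    using F by (intro loc_int_norm antideriv_loc_int)
  show ?thesis
    unfolding antideriv_def
  proof (intro conjI li allI impI)
    fix x y assume xy: "x \<le> y" and sub: "{x..y} \<subseteq> I"
    show "((\<lambda>t. f t * \<phi>' (F t)) has_integral \<phi> (F y) - \<phi> (F x)) {x..y}"
    proof (rule has_integral_from_local_increments[OF xy loc_int_integrable[OF li sub] loc_int_integrable[OF lk sub]])
      fix \<epsilon> t :: real assume "\<epsilon> > 0" "x \<le> t" "t \<le> y"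
      then have tI: "t \<in> I" using sub by auto
      have "\<epsilon> / 2 > 0" using \<open>\<epsilon> > 0\<close> by simp
      then obtain \<delta> where d: "\<delta> > 0" "\<And>s. s \<in> I \<Longrightarrow> dist s t < \<delta> \<Longrightarrow> dist (\<phi>' (F s)) (\<phi>' (F t)) < \<epsilon> / 2"
        using c\<phi> tI unfolding continuous_on_iff by meson
      show "\<exists>\<delta>>0. \<forall>u v. x \<le> u \<longrightarrow> u \<le> t \<longrightarrow> t \<le> v \<longrightarrow> v \<le> y \<longrightarrow> v - u < \<delta> \<longrightarrow>
          norm (\<phi> (F v) - \<phi> (F u) - integral {u..v} (\<lambda>t. f t * \<phi>' (F t)))
          \<le> \<epsilon> * integral {u..v} (\<lambda>t. norm (f t))"
      proof (intro exI[of _ \<delta>] conjI allI impI d)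
        fix u v assume uv: "x \<le> u" "u \<le> t" "t \<le> v" "v \<le> y" "v - u < \<delta>"
        then have suv: "{u..v} \<subseteq> I" and uv': "u \<le> v" using sub by auto
        have "\<exists>\<tau>\<in>{u..v}. \<phi> (F v) - \<phi> (F u) = (F v - F u) * \<phi>' (F \<tau>)"
        proof -
          \<comment> \<open>The mean value theorem gives a point between F u and F v; connectedness
            of the image pulls it back to some \<tau> in \<open>{u..v}\<close>, where the hypotheses
            on \<phi> apply.\<close>
          have con: "connected (F ` {u..v})"
            using cF suv by (intro connected_continuous_image connected_Icc) (auto intro: continuous_on_subset)
          have im: "{min (F u) (F v)..max (F u) (F v)} \<subseteq> F ` {u..v}"
            using con uv' by (intro connected_contains_Icc) (auto simp: min_def max_def)
          consider "F u = F v" | "F u < F v" | "F v < F u" by linarith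
          then show ?thesis
          proof cases
            case 1
            then show ?thesis using uv' by (auto intro!: bexI[of _ u])
          next
            case 2
            have der: "DERIV \<phi> z :> \<phi>' z" if "F u \<le> z" "z \<le> F v" for z
            proof -
              have "z \<in> F ` {u..v}" using im that 2 by auto
              then show ?thesis using \<phi> suv by blast
            qed
            from MVT2[OF 2 der] obtain z where "F u < z" "z < F v" "\<phi> (F v) - \<phi> (F u) = (F v - F u) * \<phi>' z"
              by auto
            moreover from this have "z \<in> F ` {u..v}"
              using im 2 by auto
            then obtain \<tau> where "\<tau> \<in> {u..v}" "z = F \<tau>"
              by blast
            ultimately show ?thesis by blast
          next
            case 3
            have der: "DERIV \<phi> z :> \<phi>' z" if "F v \<le> z" "z \<le> F u" for z
            proof -
              have "z \<in> F ` {u..v}" using im that 3 by auto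
              then show ?thesis using \<phi> suv by blast
            qed
            from MVT2[OF 3 der] obtain z where "F v < z" "z < F u" "\<phi> (F u) - \<phi> (F v) = (F u - F v) * \<phi>' z"
              by auto
            moreover from this have "z \<in> F ` {u..v}"
              using im 3 by auto
            then obtain \<tau> where "\<tau> \<in> {u..v}" "z = F \<tau>"
              by blast
            ultimately show ?thesis by (intro bexI[of _ \<tau>]) (auto simp: algebra_simps)
          qed
        qed
        then obtain \<tau> where \<tau>: "\<tau> \<in> {u..v}" "\<phi> (F v) - \<phi> (F u) = (F v - F u) * \<phi>' (F \<tau>)"
          by blast
        have close: "\<bar>\<phi>' (F \<tau>) - \<phi>' (F s)\<bar> \<le> \<epsilon>" if "s \<in> {u..v}" for s
        proof -
          have "\<tau> \<in> I" "s \<in> I" "dist \<tau> t < \<delta>" "dist s t < \<delta>"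
            using uv that suv \<tau>(1) by (auto simp: dist_real_def)
          then have "dist (\<phi>' (F \<tau>)) (\<phi>' (F t)) < \<epsilon> / 2" "dist (\<phi>' (F s)) (\<phi>' (F t)) < \<epsilon> / 2"
            using d(2) by blast+
          then have "dist (\<phi>' (F \<tau>)) (\<phi>' (F s)) < \<epsilon>"
            using dist_triangle_half_l by blast
          then show ?thesis by (simp add: dist_real_def)
        qed
        have i1: "((\<lambda>s. f s * \<phi>' (F \<tau>)) has_integral (F v - F u) * \<phi>' (F \<tau>)) {u..v}"
          by (intro has_integral_mult_left antideriv_has_integral[OF F uv' suv])
        note i4 = has_integral_diff[OF i1 integrable_integral[OF loc_int_integrable[OF li suv]], folded \<tau>(2)]
        have "norm (integral {u..v} (\<lambda>s. f s * \<phi>' (F \<tau>) - f s * \<phi>' (F s)))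
          \<le> integral {u..v} (\<lambda>s. \<epsilon> * norm (f s))"
        proof (rule integral_norm_bound_integral)
          show "(\<lambda>s. \<epsilon> * norm (f s)) integrable_on {u..v}"
            using integrable_cmul[OF loc_int_integrable[OF lk suv]] by simp
          fix s assume s: "s \<in> {u..v}"
          have "norm (f s * \<phi>' (F \<tau>) - f s * \<phi>' (F s)) = \<bar>f s\<bar> * \<bar>\<phi>' (F \<tau>) - \<phi>' (F s)\<bar>"
            by (simp add: abs_mult flip: right_diff_distrib)
          also have "\<dots> \<le> \<bar>f s\<bar> * \<epsilon>"
            using close[OF s] by (intro mult_left_mono) auto
          finally show "norm (f s * \<phi>' (F \<tau>) - f s * \<phi>' (F s)) \<le> \<epsilon> * norm (f s)"
            by (simp add: mult.commute)
        qed (use i4 in blast)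
        then show "norm (\<phi> (F v) - \<phi> (F u) - integral {u..v} (\<lambda>t. f t * \<phi>' (F t)))
          \<le> \<epsilon> * integral {u..v} (\<lambda>t. norm (f t))"
          using i4 by (simp add: has_integral_iff)
      qed
    qed
  qed
qed

section \<open>Absolute continuity and differentiability almost everywhere\<close>

text \<open>Absolute continuity of the integral by truncation: where the norm of \<open>f\<close>
  exceeds a large \<open>n\<close> it contributes less than \<epsilon>/2 in total, by dominated
  convergence, and elsewhere at most \<open>n\<close> times the length.\<close>

lemma antideriv_imp_AC_on:
  fixes F :: "real \<Rightarrow> complex"
  assumes F: "antideriv I f F" and sub: "{c..d} \<subseteq> I"
  shows "AC_on c d F"
  unfolding AC_on_def
proof (intro allI impI)
  fix \<epsilon> :: real assume "\<epsilon> > 0"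
  define h where "h n t = (if norm (f t) > real n then norm (f t) else 0)" for n t
  have f: "f absolutely_integrable_on {c..d}"
    using F sub antideriv_loc_int loc_int_D by blast
  have nf: "(\<lambda>t. norm (f t)) integrable_on {c..d}"
    using f by (simp add: absolutely_integrable_on_def)
  have mf: "f \<in> borel_measurable (lebesgue_on {c..d})"
    using f by (intro absolutely_integrable_imp_borel_measurable) auto
  have hint: "h n integrable_on {c..d}" for n
  proof -
    have "h n absolutely_integrable_on {c..d}"
    proof (rule measurable_bounded_by_integrable_imp_absolutely_integrable[OF _ _ nf])
      show "h n \<in> borel_measurable (lebesgue_on {c..d})"
        unfolding h_def using mf by measurable
    qed (auto simp: h_def)
    then show ?thesis by (rule set_lebesgue_integral_eq_integral(1))
  qed
  have "(\<lambda>n. integral {c..d} (h n)) \<longlonglongrightarrow> integral {c..d} (\<lambda>t. 0)"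
  proof (rule dominated_convergence(2)[OF hint nf])
    fix t
    obtain N where "norm (f t) \<le> real N" using real_arch_simple by blast
    then have "h n t = 0" if "n \<ge> N" for n
      using that by (auto simp: h_def)
    then show "(\<lambda>n. h n t) \<longlonglongrightarrow> 0"
      by (intro tendsto_eventually eventually_sequentiallyI[of N])
  qed (auto simp: h_def)
  then have "\<forall>\<^sub>F n in sequentially. integral {c..d} (h n) < \<epsilon> / 2"
    using \<open>\<epsilon> > 0\<close> by (intro order_tendstoD) auto
  then obtain n where n: "integral {c..d} (h n) < \<epsilon> / 2"
    by (meson eventually_happens sequentially_bot)
  \<comment> \<open>The summand 1 covers the case n = 0; in all cases n \<delta> is at most
    \<epsilon>/2.\<close>
  define \<delta> where "\<delta> = \<epsilon> / (2 * (real n + 1))"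
  have "\<delta> > 0" using \<open>\<epsilon> > 0\<close> by (simp add: \<delta>_def)
  show "\<exists>\<delta>>0. \<forall>P :: (real \<times> real) set.
        finite P \<longrightarrow> (\<forall>(x, y)\<in>P. c \<le> x \<and> x < y \<and> y \<le> d) \<longrightarrow>
        pairwise (\<lambda>(x, y) (x', y'). {x<..<y} \<inter> {x'<..<y'} = {}) P \<longrightarrow>
        (\<Sum>(x, y)\<in>P. y - x) < \<delta> \<longrightarrow> (\<Sum>(x, y)\<in>P. cmod (F y - F x)) < \<epsilon>"
  proof (intro exI[of _ \<delta>] conjI allI impI \<open>\<delta> > 0\<close>)
    fix P :: "(real \<times> real) set"
    assume P: "finite P" and in_cd: "\<forall>(x, y)\<in>P. c \<le> x \<and> x < y \<and> y \<le> d"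
      and dis: "pairwise (\<lambda>(x, y) (x', y'). {x<..<y} \<inter> {x'<..<y'} = {}) P"
      and small: "(\<Sum>(x, y)\<in>P. y - x) < \<delta>"
    have hi: "h n integrable_on {fst p..snd p}" if "p \<in> P" for p
      using in_cd that by (intro integrable_subinterval_real[OF hint]) auto
    have single: "cmod (F (snd p) - F (fst p)) \<le>
        real n * (snd p - fst p) + integral {fst p..snd p} (h n)" if "p \<in> P" for p
    proof -
      have xy: "c \<le> fst p" "fst p \<le> snd p" "snd p \<le> d" using in_cd that by auto
      then have sxy: "{fst p..snd p} \<subseteq> I" using sub by auto
      note i = antideriv_has_integral[OF F xy(2) sxy]
      have i2: "((\<lambda>t. real n + h n t) has_integral
          (real n * (snd p - fst p) + integral {fst p..snd p} (h n))) {fst p..snd p}"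
        using has_integral_add[OF has_integral_const_real[of "real n" "fst p" "snd p"] integrable_integral[OF hi[OF that]]] xy
        by (simp add: mult.commute)
      have "norm (integral {fst p..snd p} f) \<le> integral {fst p..snd p} (\<lambda>t. real n + h n t)"
        using i i2 by (intro integral_norm_bound_integral) (auto simp: has_integral_iff h_def)
      then show ?thesis
        using i i2 by (simp add: has_integral_iff)
    qed
    have un: "(h n has_integral (\<Sum>p\<in>P. integral {fst p..snd p} (h n))) (\<Union>p\<in>P. {fst p<..<snd p})"
    proof (rule has_integral_UN[OF P])
      show "(h n has_integral integral {fst p..snd p} (h n)) {fst p<..<snd p}" if "p \<in> P" for p
        using integrable_integral[OF hi[OF that]] has_integral_Icc_iff_Ioo by blast
      show "pairwise (\<lambda>p q. negligible ({fst p<..<snd p} \<inter> {fst q<..<snd q})) P"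
        using dis by (rule pairwise_mono) (auto simp: case_prod_unfold)
    qed
    have "(\<Sum>p\<in>P. integral {fst p..snd p} (h n)) \<le> integral {c..d} (h n)"
    proof (rule has_integral_subset_le[OF _ un integrable_integral[OF hint]])
      show "(\<Union>p\<in>P. {fst p<..<snd p}) \<subseteq> {c..d}"
        using in_cd by fastforce
    qed (auto simp: h_def)
    moreover have "(\<Sum>p\<in>P. cmod (F (snd p) - F (fst p))) \<le>
        real n * (\<Sum>p\<in>P. snd p - fst p) + (\<Sum>p\<in>P. integral {fst p..snd p} (h n))"
      using sum_mono[OF single] by (simp add: sum.distrib sum_distrib_left)
    moreover have "real n * (\<Sum>p\<in>P. snd p - fst p) \<le> real n * \<delta>"
      using small by (intro mult_left_mono) (auto simp: case_prod_unfold)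
    moreover have "real n * \<delta> \<le> \<epsilon> / 2"
      using \<open>\<epsilon> > 0\<close> by (simp add: \<delta>_def field_simps)
    ultimately show "(\<Sum>(x, y)\<in>P. cmod (F y - F x)) < \<epsilon>"
      using n by (simp add: case_prod_unfold)
  qed
qed

lemma antideriv_imp_AC_loc:
  "antideriv (einterval a b) f F \<Longrightarrow> AC_loc a b F"
  using antideriv_imp_AC_on unfolding AC_loc_def by blast

text \<open>The Lebesgue differentiation theorem in use concerns averages over [x, x + h] only and
  so yields right derivatives. Left derivatives come from applying it to the reflected integrand at
  -x; reflection preserves null sets.\<close>

lemma antideriv_vector_derivative_on_Icc:
  fixes f :: "real \<Rightarrow> 'a::euclidean_space"
  assumes F: "antideriv {l..u} f F"
  shows "AE x in lebesgue. x \<in> {l<..<u} \<longrightarrow> (F has_vector_derivative f x) (at x)"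
proof -
  \<comment> \<open>Extension by zero, because the differentiation theorem asks for integrability on
    every box.\<close>
  define f0 where "f0 t = (if t \<in> {l..u} then f t else 0)" for t
  have fi: "f integrable_on {l..u}"
    using F antideriv_loc_int loc_int_integrable by blast
  have i0: "f0 integrable_on UNIV"
    unfolding f0_def using fi integrable_restrict_UNIV by blast
  have i1: "f0 integrable_on cbox x y" for x y
    using i0 by (rule integrable_on_subcbox) auto
  have i2: "(\<lambda>t. f0 (- t)) integrable_on cbox x y" for x y
    using i1[of "- y" "- x"] integrable_reflect[where f = f0 and a = "- y" and b = "- x"] by simp
  obtain N1 where N1: "negligible N1" "\<And>x e. x \<notin> N1 \<Longrightarrow> 0 < e \<Longrightarrow>
     \<exists>d>0. \<forall>h. 0 < h \<and> h < d \<longrightarrow> norm (integral (cbox x (x + h *\<^sub>R One)) f0 /\<^sub>R h ^ DIM(real) - f0 x) < e"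
    using integrable_ccontinuous_explicit[OF i1] by metis
  obtain N2 where N2: "negligible N2" "\<And>x e. x \<notin> N2 \<Longrightarrow> 0 < e \<Longrightarrow>
     \<exists>d>0. \<forall>h. 0 < h \<and> h < d \<longrightarrow>
       norm (integral (cbox x (x + h *\<^sub>R One)) (\<lambda>t. f0 (- t)) /\<^sub>R h ^ DIM(real) - f0 (- x)) < e"
    using integrable_ccontinuous_explicit[OF i2] by metis
  have "negligible (N1 \<union> uminus ` N2)"
    using N1(1) N2(1)
    by (intro negligible_Un negligible_differentiable_image_negligible derivative_intros) auto
  then have "AE x in lebesgue. x \<notin> N1 \<union> uminus ` N2"
    using AE_not_in negligible_iff_null_sets by blast
  then show ?thesis
  proof eventually_elim
    case (elim x)
    show ?case
    proof
      assume x: "x \<in> {l<..<u}"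
      have F0: "F w - F v = integral {v..w} f0" if "l \<le> v" "v \<le> w" "w \<le> u" for v w
      proof -
        have "(f has_integral (F w - F v)) {v..w}"
          using that by (intro antideriv_has_integral[OF F]) auto
        then have "(f0 has_integral (F w - F v)) {v..w}"
          by (rule has_integral_eq[rotated]) (use that in \<open>auto simp: f0_def\<close>)
        then show ?thesis by (simp add: has_integral_iff)
      qed
      have fx: "f0 x = f x" using x by (simp add: f0_def)
      show "(F has_vector_derivative f x) (at x)"
        unfolding has_vector_derivative_def has_derivative_at_alt
      proof (intro conjI allI impI)
        show "bounded_linear (\<lambda>h. h *\<^sub>R f x)" by (rule bounded_linear_scaleR_left)
        fix e :: real assume "e > 0"
        have "x \<notin> N1" "- x \<notin> N2" using elim by (auto simp: image_iff)
        obtain d1 where d1: "d1 > 0" "\<And>h. 0 < h \<Longrightarrow> h < d1 \<Longrightarrow> norm (integral {x..x + h} f0 /\<^sub>R h - f x) < e"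
          using N1(2)[OF \<open>x \<notin> N1\<close> \<open>e > 0\<close>] by (auto simp: fx)
        obtain d2 where d2: "d2 > 0" "\<And>h. 0 < h \<Longrightarrow> h < d2 \<Longrightarrow>
            norm (integral {- x..- x + h} (\<lambda>t. f0 (- t)) /\<^sub>R h - f x) < e"
          using N2(2)[OF \<open>- x \<notin> N2\<close> \<open>e > 0\<close>] by (auto simp: fx)
        have scale: "norm (v - h *\<^sub>R f x) \<le> e * h" if "norm (v /\<^sub>R h - f x) < e" "h > 0" for v h
        proof -
          have "v - h *\<^sub>R f x = h *\<^sub>R (v /\<^sub>R h - f x)" using that by (simp add: algebra_simps)
          then have "norm (v - h *\<^sub>R f x) = h * norm (v /\<^sub>R h - f x)" using that by simp
          then show ?thesis using that by (simp add: mult.commute)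
        qed
        define d where "d = Min {d1, d2, x - l, u - x}"
        have "d > 0" using d1 d2 x by (simp add: d_def)
        show "\<exists>d>0. \<forall>y. norm (y - x) < d \<longrightarrow>
            norm (F y - F x - (y - x) *\<^sub>R f x) \<le> e * norm (y - x)"
        proof (intro exI[of _ d] conjI allI impI \<open>d > 0\<close>)
          fix y assume y: "norm (y - x) < d"
          then have yd: "\<bar>y - x\<bar> < d1" "\<bar>y - x\<bar> < d2" "l < y" "y < u"
            by (auto simp: d_def)
          consider "y = x" | "x < y" | "y < x" by linarith
          then show "norm (F y - F x - (y - x) *\<^sub>R f x) \<le> e * norm (y - x)"
          proof cases
            case 2
            then have "F y - F x = integral {x..x + (y - x)} f0"
              using F0[of x y] x yd by simp
            then show ?thesis
              using scale[OF d1(2), of "y - x"] 2 yd by simp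
          next
            case 3
            then have "F x - F y = integral {- x..- x + (x - y)} (\<lambda>t. f0 (- t))"
              using F0[of y x] x yd by simp
            then have "norm (F x - F y - (x - y) *\<^sub>R f x) \<le> e * (x - y)"
              using scale[OF d2(2), of "x - y"] 3 yd by simp
            moreover have "F y - F x - (y - x) *\<^sub>R f x = - (F x - F y - (x - y) *\<^sub>R f x)"
              by (simp add: algebra_simps)
            ultimately show ?thesis
              using 3 by (simp only: norm_minus_cancel) simp
          qed simp
        qed
      qed
    qed
  qed
qed

text \<open>Every point of an open set lies inside a rational interval contained in it, and
  countably many null sets have a null union.\<close>

lemma antideriv_AE_vector_derivative:
  fixes f :: "real \<Rightarrow> 'a::euclidean_space"
  assumes F: "antideriv I f F" and "open I"
  shows "AE x in lebesgue. x \<in> I \<longrightarrow> (F has_vector_derivative f x) (at x)"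
proof -
  have "AE x in lebesgue. \<forall>p q :: rat. {real_of_rat p..real_of_rat q} \<subseteq> I \<longrightarrow>
      x \<in> {real_of_rat p<..<real_of_rat q} \<longrightarrow> (F has_vector_derivative f x) (at x)"
    unfolding AE_all_countable
    using antideriv_vector_derivative_on_Icc[OF antideriv_subset[OF F]] by auto
  then show ?thesis
  proof eventually_elim
    case (elim x)
    show ?case
    proof
      assume "x \<in> I"
      then obtain e where e: "e > 0" "cball x e \<subseteq> I"
        using assms(2) open_contains_cball by blast
      obtain p where p: "x - e < real_of_rat p" "real_of_rat p < x"
        using of_rat_dense[of "x - e" x] e by auto
      obtain q where q: "x < real_of_rat q" "real_of_rat q < x + e"
        using of_rat_dense[of x "x + e"] e by auto
      have "{real_of_rat p..real_of_rat q} \<subseteq> I"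
        using p q e by (auto simp: cball_eq_atLeastAtMost subset_iff)
      then show "(F has_vector_derivative f x) (at x)"
        using elim p q by auto
    qed
  qed
qed

section \<open>Linear systems with locally integrable coefficients\<close>

lemma antideriv_exists:
  fixes f :: "real \<Rightarrow> 'a::euclidean_space"
  assumes f: "loc_int I f" and I: "is_interval I" "c \<in> I"
  shows "\<exists>F. F c = x0 \<and> antideriv I f F"
proof -
  define F where "F t = x0 + (if c \<le> t then integral {c..t} f else - integral {t..c} f)" for t
  have "(f has_integral F y - F x) {x..y}" if xy: "x \<le> y" "{x..y} \<subseteq> I" for x y
  proof -
    have "x \<in> I" "y \<in> I" using xy by auto
    then have int: "f integrable_on {u..v}" if "u \<in> {x, y, c}" "v \<in> {x, y, c}" for u v
      using that I f by (intro loc_int_integrable[OF f] is_interval_Icc_subset) auto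
    note comb = Henstock_Kurzweil_Integration.integral_combine[OF _ _ int]
    have "F y - F x = integral {x..y} f"
      using comb[of c x y] comb[of x c y] comb[of x y c] xy(1)
      by (auto simp: F_def algebra_simps)
    then show ?thesis using int[of x y] by (simp add: has_integral_iff)
  qed
  moreover have "F c = x0" by (simp add: F_def)
  ultimately show ?thesis using f unfolding antideriv_def by blast
qed

text \<open>Picard iteration on all of \<open>I\<close> at once, measured against the weight
  \<open>E\<close> = cosh(2 K) with K' = k and K(c) = 0. From c to t the integral of k E is sinh(2
  K)/2, at most E/2 in modulus, so each step gains a factor 1/2. An even weight is chosen because
  \<open>K\<close> changes sign at c.\<close>

lemma linear_ODE_exists:
  fixes A :: "real \<Rightarrow> 'a::euclidean_space \<Rightarrow> 'a"
  assumes I: "open I" "is_interval I" "c \<in> I" and k: "loc_int I k"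
    and A0: "\<And>t. t \<in> I \<Longrightarrow> A t 0 = 0"
    and lip: "\<And>t x y. t \<in> I \<Longrightarrow> norm (A t x - A t y) \<le> k t * norm (x - y)"
    and int: "\<And>X. continuous_on I X \<Longrightarrow> loc_int I (\<lambda>t. A t (X t))"
  shows "\<exists>Y. Y c = x0 \<and> antideriv I (\<lambda>t. A t (Y t)) Y"
proof -
  \<comment> \<open>The Lipschitz bound between 0 and a nonzero basis vector forces the constant to
    be nonnegative.\<close>
  have k0: "k t \<ge> 0" if "t \<in> I" for t
  proof -
    obtain b :: 'a where "b \<in> Basis" using nonempty_Basis by blast
    then show ?thesis
      using lip[OF that, of b 0] norm_ge_zero[of "A t b - A t 0"] by (simp del: norm_ge_zero)
  qed
  obtain K where K: "K c = 0" "antideriv I k K"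
    using antideriv_exists[OF k I(2,3), of 0] by blast
  have cK: "continuous_on I K"
    using K(2) I(1) by (rule antideriv_continuous_on)
  define E where "E t = cosh (2 * K t)" for t
  have cE: "continuous_on I E"
    unfolding E_def by (intro continuous_intros cK)
  have sinh_prim: "antideriv I (\<lambda>t. k t * E t) (\<lambda>t. sinh (2 * K t) / 2)"
    unfolding E_def
    by (rule antideriv_chain[OF K(2) I(1), where \<phi> = "\<lambda>x. sinh (2 * x) / 2" and \<phi>' = "\<lambda>x. cosh (2 * x)"])
       (auto intro!: derivative_eq_intros continuous_intros cK)
  define step where "step X = (SOME Z. Z c = x0 \<and> antideriv I (\<lambda>t. A t (X t)) Z)" for X
  have step: "step X c = x0 \<and> antideriv I (\<lambda>t. A t (X t)) (step X)" if "continuous_on I X" for X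
    unfolding step_def by (rule someI_ex[OF antideriv_exists[OF int[OF that] I(2,3)]])
  define S where "S n = (step ^^ n) (\<lambda>_. 0)" for n
  have S_Suc: "S (Suc n) = step (S n)" for n by (simp add: S_def)
  have cS: "continuous_on I (S n)" for n
  proof (induction n)
    case 0
    then show ?case by (simp add: S_def)
  next
    case (Suc n)
    then show ?case
      unfolding S_Suc using step antideriv_continuous_on I(1) by blast
  qed
  have Sc: "S (Suc n) c = x0" and Sa: "antideriv I (\<lambda>t. A t (S n t)) (S (Suc n))" for n
    using step[OF cS] by (simp_all add: S_Suc)
  have diff: "norm (S (Suc n) t - S n t) \<le> norm x0 * (1 / 2) ^ n * E t" if "t \<in> I" for n t
    using that
  proof (induction n arbitrary: t)
    case 0
    \<comment> \<open>The iteration starts at 0, where \<open>A\<close> vanishes, so the first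
      iterate is the constant \<open>x0\<close>; since E is at least 1, this anchors the geometric
      bound.\<close>
    have "norm (S 1 t - S 1 c) \<le> \<bar>0 - 0\<bar>"
      by (rule antideriv_norm_bound[OF _ antideriv_const I(2,3) 0, where f = "\<lambda>t. A t (S 0 t)"])
         (use Sa[of 0] A0 in \<open>auto simp: S_def\<close>)
    then have "S 1 t = x0" using Sc[of 0] by simp
    moreover have "norm x0 * 1 \<le> norm x0 * E t"
      unfolding E_def by (intro mult_left_mono cosh_real_ge_1) auto
    ultimately show ?case by (simp add: S_def)
  next
    case (Suc n)
    let ?C = "norm x0 * (1 / 2) ^ n"
    have "norm ((S (Suc (Suc n)) t - S (Suc n) t) - (S (Suc (Suc n)) c - S (Suc n) c))
      \<le> \<bar>?C * (sinh (2 * K t) / 2) - ?C * (sinh (2 * K c) / 2)\<bar>"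
    proof (rule antideriv_norm_bound[OF antideriv_diff[OF Sa Sa]
           antideriv_linear[OF sinh_prim bounded_linear_mult_right] I(2,3) Suc.prems])
      fix s assume s: "s \<in> I"
      have "norm (A s (S (Suc n) s) - A s (S n s)) \<le> k s * norm (S (Suc n) s - S n s)"
        using lip[OF s] .
      moreover have "k s \<ge> 0" using k0[OF s] .
      ultimately show "norm (A s (S (Suc n) s) - A s (S n s)) \<le> ?C * (k s * E s)"
        using mult_left_mono[OF Suc.IH[OF s], of "k s"] by (simp add: mult_ac)
    qed
    also have "\<dots> = ?C / 2 * \<bar>sinh (2 * K t)\<bar>"
      by (simp add: K(1) abs_mult)
    also have "\<dots> \<le> ?C / 2 * E t"
    proof (intro mult_left_mono)
      have "sinh x \<le> cosh x \<and> - sinh x \<le> cosh x" for x :: real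
        by (simp add: sinh_def cosh_def field_simps)
      then show "\<bar>sinh (2 * K t)\<bar> \<le> E t" unfolding E_def by (simp add: abs_le_iff)
    qed auto
    finally show ?case by (simp add: Sc)
  qed
  define Y where "Y t = (\<Sum>i. S (Suc i) t - S i t)" for t
  have geo: "summable (\<lambda>i. C * (1 / 2 :: real) ^ i * e)" for C e
    by (intro summable_mult summable_mult2 summable_geometric) simp
  have err: "norm (Y t - S n t) \<le> 2 * norm x0 * E t * (1 / 2) ^ n" if t: "t \<in> I" for n t
  proof -
    have sm: "summable (\<lambda>i. S (Suc i) t - S i t)"
      using diff[OF t] by (rule summable_comparison_test'[OF geo])
    have "S n t = (\<Sum>i<n. S (Suc i) t - S i t)"
      by (subst sum_lessThan_telescope) (simp add: S_def)
    then have "Y t - S n t = (\<Sum>i. S (Suc (i + n)) t - S (i + n) t)"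
      unfolding Y_def using suminf_minus_initial_segment[OF sm, of n] by simp
    also have "norm \<dots> \<le> (\<Sum>i. norm x0 * (1 / 2) ^ n * (1 / 2) ^ i * E t)"
    proof (rule norm_suminf_le[OF _ geo])
      show "norm (S (Suc (i + n)) t - S (i + n) t) \<le> norm x0 * (1 / 2) ^ n * (1 / 2) ^ i * E t" for i
        using diff[OF t, of "i + n"] by (simp add: power_add mult_ac)
    qed
    also have "\<dots> = norm x0 * (1 / 2) ^ n * 2 * E t"
      by (subst suminf_mult2[symmetric], (intro summable_mult summable_geometric, simp)[1])
         (subst suminf_mult, (intro summable_geometric, simp)[1], simp add: suminf_geometric)
    finally show ?thesis by (simp add: mult_ac)
  qed
  \<comment> \<open>\<open>E\<close> may be unbounded near the ends of \<open>I\<close>, so uniform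
    convergence is claimed on compact subintervals; this suffices for continuity of the limit and
    for passing to the limit under the integral.\<close>
  have unif: "\<exists>M\<ge>0. \<forall>t\<in>{x..y}. \<forall>n. norm (Y t - S n t) \<le> M * (1 / 2) ^ n" if "{x..y} \<subseteq> I" for x y
  proof -
    have "bounded (E ` {x..y})"
      using cE that by (intro compact_imp_bounded compact_continuous_image) (auto intro: continuous_on_subset)
    then obtain M where M: "M > 0" "\<And>t. t \<in> {x..y} \<Longrightarrow> norm (E t) \<le> M"
      by (auto simp: bounded_pos)
    show ?thesis
    proof (intro exI[of _ "2 * norm x0 * M"] conjI ballI allI)
      fix t n assume t: "t \<in> {x..y}"
      have "norm (Y t - S n t) \<le> 2 * norm x0 * E t * (1 / 2) ^ n"
        using err t that by auto
      also have "\<dots> \<le> 2 * norm x0 * M * (1 / 2) ^ n"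
        using M(2)[OF t] by (intro mult_right_mono mult_left_mono) auto
      finally show "norm (Y t - S n t) \<le> 2 * norm x0 * M * (1 / 2) ^ n" .
    qed (use M in auto)
  qed
  have half: "(\<lambda>n. C * (1 / 2 :: real) ^ n) \<longlonglongrightarrow> 0" for C
    by (rule tendsto_mult_right_zero) (intro LIMSEQ_realpow_zero, auto)
  have lim: "(\<lambda>n. S n t) \<longlonglongrightarrow> Y t" if "t \<in> I" for t
  proof -
    have "(\<lambda>n. Y t - S n t) \<longlonglongrightarrow> 0"
      by (rule Lim_null_comparison[OF _ half]) (use err[OF that] in \<open>auto intro: always_eventually\<close>)
    from tendsto_diff[OF tendsto_const[of "Y t"] this] show ?thesis by simp
  qed
  have cY: "continuous_on I Y"
  proof (rule continuous_on_open_from_Icc[OF I(1)])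
    fix x y assume xy: "{x..y} \<subseteq> I"
    obtain M where M: "\<forall>t\<in>{x..y}. \<forall>n. norm (Y t - S n t) \<le> M * (1 / 2) ^ n"
      using unif[OF xy] by blast
    have "uniform_limit {x..y} S Y sequentially"
    proof (rule uniform_limitI)
      fix e :: real assume "e > 0"
      then have "\<forall>\<^sub>F n in sequentially. M * (1 / 2) ^ n < e"
        using half[of M] by (intro order_tendstoD)
      then show "\<forall>\<^sub>F n in sequentially. \<forall>t\<in>{x..y}. dist (S n t) (Y t) < e"
      proof eventually_elim
        case (elim n)
        show ?case
        proof
          fix t assume "t \<in> {x..y}"
          then have "norm (Y t - S n t) \<le> M * (1 / 2) ^ n" using M by blast
          with elim have "norm (Y t - S n t) < e" by (rule le_less_trans[rotated])
          then show "dist (S n t) (Y t) < e" by (metis dist_norm dist_commute)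
        qed
      qed
    qed
    then show "continuous_on {x..y} Y"
      using continuous_on_subset[OF cS xy] by (intro uniform_limit_theorem[where f = S]) auto
  qed
  have liY: "loc_int I (\<lambda>t. A t (Y t))" using int[OF cY] .
  have "antideriv I (\<lambda>t. A t (Y t)) Y"
    unfolding antideriv_def
  proof (intro conjI liY allI impI)
    fix x y assume le: "x \<le> y" and xy: "{x..y} \<subseteq> I"
    obtain M where M: "M \<ge> 0" "\<forall>t\<in>{x..y}. \<forall>n. norm (Y t - S n t) \<le> M * (1 / 2) ^ n"
      using unif[OF xy] by blast
    have lim1: "(\<lambda>n. S (Suc n) y - S (Suc n) x) \<longlonglongrightarrow> Y y - Y x"
      using le xy by (intro tendsto_diff LIMSEQ_Suc lim) auto
    note iY = integrable_integral[OF loc_int_integrable[OF liY xy]]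
    have "(\<lambda>n. (S (Suc n) y - S (Suc n) x) - integral {x..y} (\<lambda>t. A t (Y t))) \<longlonglongrightarrow> 0"
    proof (rule Lim_null_comparison[OF _ half])
      show "\<forall>\<^sub>F n in sequentially. norm ((S (Suc n) y - S (Suc n) x) - integral {x..y} (\<lambda>t. A t (Y t)))
          \<le> (integral {x..y} k * M) * (1 / 2) ^ n"
      proof (intro always_eventually allI)
        fix n
        note iD = has_integral_diff[OF antideriv_has_integral[OF Sa le xy] iY]
        have ik: "((\<lambda>t. k t * (M * (1 / 2) ^ n)) has_integral (integral {x..y} k * (M * (1 / 2) ^ n))) {x..y}"
          by (intro has_integral_mult_left integrable_integral loc_int_integrable[OF k xy])
        have "norm (integral {x..y} (\<lambda>t. A t (S n t) - A t (Y t))) \<le> integral {x..y} (\<lambda>t. k t * (M * (1 / 2) ^ n))"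
        proof (rule integral_norm_bound_integral)
          fix t assume t: "t \<in> {x..y}"
          then have tI: "t \<in> I" using xy by auto
          have "norm (A t (S n t) - A t (Y t)) \<le> k t * norm (S n t - Y t)"
            using lip[OF tI] .
          also have "\<dots> \<le> k t * (M * (1 / 2) ^ n)"
            using M(2) t k0[OF tI] by (intro mult_left_mono) (auto simp: norm_minus_commute)
          finally show "norm (A t (S n t) - A t (Y t)) \<le> k t * (M * (1 / 2) ^ n)" .
        qed (use iD ik in blast)+
        then show "norm ((S (Suc n) y - S (Suc n) x) - integral {x..y} (\<lambda>t. A t (Y t)))
          \<le> (integral {x..y} k * M) * (1 / 2) ^ n"
          using iD ik by (simp add: has_integral_iff mult.assoc)
      qed
    qed
    from tendsto_add[OF this tendsto_const[of "integral {x..y} (\<lambda>t. A t (Y t))"]]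
    have "(\<lambda>n. S (Suc n) y - S (Suc n) x) \<longlonglongrightarrow> integral {x..y} (\<lambda>t. A t (Y t))"
      by simp
    with lim1 have "Y y - Y x = integral {x..y} (\<lambda>t. A t (Y t))"
      by (rule LIMSEQ_unique)
    with iY show "((\<lambda>t. A t (Y t)) has_integral Y y - Y x) {x..y}" by simp
  qed
  moreover have "Y c = x0"
    using LIMSEQ_unique[OF LIMSEQ_Suc[OF lim[OF I(3)]]] Sc by simp
  ultimately show ?thesis by blast
qed

section \<open>The Sturm-Liouville equation as a first-order system, its Wronskian, and Gronwall's
  inequality\<close>

lemma loc_int_Pair: "loc_int I f \<Longrightarrow> loc_int I g \<Longrightarrow> loc_int I (\<lambda>t. (f t, g t))"
  using loc_int_add[OF loc_int_linear[where h = "\<lambda>x. (x, 0)"] loc_int_linear[where h = "\<lambda>x. (0, x)"]]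
  by (simp add: bounded_linear_Pair)

lemma loc_int_scaleR:
  fixes X :: "real \<Rightarrow> 'a::euclidean_space"
  shows "loc_int I f \<Longrightarrow> continuous_on I X \<Longrightarrow> loc_int I (\<lambda>t. f t *\<^sub>R X t)"
  by (rule loc_int_bilinear[OF bounded_bilinear_scaleR])

lemma loc_int_minus: "loc_int I f \<Longrightarrow> loc_int I (\<lambda>t. - f t)"
  by (rule loc_int_linear[where h = uminus]) (auto intro: bounded_linear_minus bounded_linear_ident)

lemma loc_int_diff: "loc_int I f \<Longrightarrow> loc_int I g \<Longrightarrow> loc_int I (\<lambda>t. f t - g t)"
  using loc_int_add[OF _ loc_int_minus] by fastforce

lemma loc_int_cmult: "loc_int I f \<Longrightarrow> loc_int I (\<lambda>t. c * f t :: real)"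
  by (rule loc_int_linear[OF _ bounded_linear_mult_right])

lemma L1_loc_loc_int: "L1_loc a b f \<longleftrightarrow> loc_int (einterval a b) f"
  by (auto simp: L1_loc_def loc_int_def)

lemma is_interval_einterval: "is_interval (einterval a b)"
  unfolding is_interval_1 einterval_def
  by (auto intro: less_le_trans le_less_trans simp flip: ereal_less_eq)

text \<open>The equation with parameter \<open>z\<close> as a system for y and its quasi-derivative:
  y' = y1/p - s y and y1' = s y1 + q y - z r y. The scalar type is left open because the angle
  argument needs real solutions and the parameter in the limit-point condition needs complex
  ones.\<close>

definition sl_system ::
  "real set \<Rightarrow> (real \<Rightarrow> real) \<Rightarrow> (real \<Rightarrow> real) \<Rightarrow> (real \<Rightarrow> real) \<Rightarrow> (real \<Rightarrow> real) \<Rightarrow>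
   'a::{real_normed_field, euclidean_space} \<Rightarrow> (real \<Rightarrow> 'a) \<Rightarrow> (real \<Rightarrow> 'a) \<Rightarrow> bool" where
  "sl_system I p q r s z y y1 \<longleftrightarrow>
     antideriv I (\<lambda>t. (1 / p t) *\<^sub>R y1 t - s t *\<^sub>R y t) y \<and>
     antideriv I (\<lambda>t. s t *\<^sub>R y1 t + q t *\<^sub>R y t - r t *\<^sub>R (z * y t)) y1"

lemma sl_system_subset:
  "sl_system I p q r s z y y1 \<Longrightarrow> J \<subseteq> I \<Longrightarrow> sl_system J p q r s z y y1"
  unfolding sl_system_def using antideriv_subset by blast

lemma sl_system_continuous_on:
  assumes "sl_system I p q r s z y y1" "open I"
  shows "continuous_on I y" "continuous_on I y1"
  using assms unfolding sl_system_def by (auto intro: antideriv_continuous_on)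

lemma sl_system_exists:
  fixes z x0 x1 :: "'a::{real_normed_field, euclidean_space}"
  assumes I: "open I" "is_interval I" "c \<in> I"
    and coeff: "loc_int I (\<lambda>t. 1 / p t)" "loc_int I q" "loc_int I r" "loc_int I s"
  shows "\<exists>y y1. y c = x0 \<and> y1 c = x1 \<and> sl_system I p q r s z y y1"
proof -
  define A where "A t x = ((1 / p t) *\<^sub>R snd x - s t *\<^sub>R fst x,
      s t *\<^sub>R snd x + q t *\<^sub>R fst x - r t *\<^sub>R (z * fst x))" for t and x :: "'a \<times> 'a"
  \<comment> \<open>The Lipschitz constant sums the moduli of all matrix entries; \<open>s\<close>
    occurs in both components, hence the factor 2.\<close>
  define k where "k t = \<bar>1 / p t\<bar> + 2 * \<bar>s t\<bar> + \<bar>q t\<bar> + norm z * \<bar>r t\<bar>" for t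
  have "\<exists>Y. Y c = (x0, x1) \<and> antideriv I (\<lambda>t. A t (Y t)) Y"
  proof (rule linear_ODE_exists[OF I])
    show "loc_int I k"
      unfolding k_def using coeff[THEN loc_int_norm]
      by (auto intro!: loc_int_add loc_int_cmult simp del: abs_divide)
    show "A t 0 = 0" for t by (simp add: A_def zero_prod_def)
    show "norm (A t x - A t y) \<le> k t * norm (x - y)" for t x y
    proof -
      define w where "w = x - y"
      have w: "norm (fst w) \<le> norm w" "norm (snd w) \<le> norm w"
        using norm_fst_le[of "fst w" "snd w"] norm_snd_le[of "snd w" "fst w"] by simp_all
      have "A t x - A t y = A t w"
        by (simp add: A_def w_def algebra_simps)
      also have "norm (A t w) \<le> norm ((1 / p t) *\<^sub>R snd w - s t *\<^sub>R fst w) +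
          norm (s t *\<^sub>R snd w + q t *\<^sub>R fst w - r t *\<^sub>R (z * fst w))"
        unfolding A_def by (rule norm_Pair_le)
      also have "\<dots> \<le> (norm ((1 / p t) *\<^sub>R snd w) + norm (s t *\<^sub>R fst w)) +
          (norm (s t *\<^sub>R snd w) + norm (q t *\<^sub>R fst w) + norm (r t *\<^sub>R (z * fst w)))"
        by (intro add_mono norm_triangle_ineq4 order_trans[OF norm_triangle_ineq4] norm_triangle_ineq order_refl)
      also have "\<dots> = \<bar>1 / p t\<bar> * norm (snd w) + \<bar>s t\<bar> * norm (fst w) +
          (\<bar>s t\<bar> * norm (snd w) + \<bar>q t\<bar> * norm (fst w) + norm z * \<bar>r t\<bar> * norm (fst w))"
        by (simp add: norm_mult mult_ac)
      also have "\<dots> \<le> \<bar>1 / p t\<bar> * norm w + \<bar>s t\<bar> * norm w +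
          (\<bar>s t\<bar> * norm w + \<bar>q t\<bar> * norm w + norm z * \<bar>r t\<bar> * norm w)"
        using w by (intro add_mono mult_left_mono) auto
      also have "\<dots> = k t * norm w"
        by (simp add: k_def algebra_simps)
      finally show ?thesis by (simp add: w_def)
    qed
    fix X :: "real \<Rightarrow> 'a \<times> 'a" assume X: "continuous_on I X"
    have cf: "continuous_on I (\<lambda>t. fst (X t))" "continuous_on I (\<lambda>t. snd (X t))"
      "continuous_on I (\<lambda>t. z * fst (X t))"
      by (intro continuous_intros X)+
    show "loc_int I (\<lambda>t. A t (X t))"
      unfolding A_def
      by (intro loc_int_Pair loc_int_add loc_int_diff loc_int_scaleR cf coeff)
  qed
  then obtain Y where Y: "Y c = (x0, x1)" "antideriv I (\<lambda>t. A t (Y t)) Y" by blast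
  have "sl_system I p q r s z (\<lambda>t. fst (Y t)) (\<lambda>t. snd (Y t))"
    using antideriv_linear[OF Y(2) bounded_linear_fst] antideriv_linear[OF Y(2) bounded_linear_snd]
    by (simp add: sl_system_def A_def)
  then show ?thesis using Y(1)
    by (intro exI[of _ "\<lambda>t. fst (Y t)"] exI[of _ "\<lambda>t. snd (Y t)"]) auto
qed

lemma sl_system_of_real:
  assumes "sl_system I p q r s \<mu> y y1"
  shows "sl_system I p q r s (complex_of_real \<mu>) (\<lambda>t. of_real (y t)) (\<lambda>t. of_real (y1 t))"
proof -
  note sys = assms[unfolded sl_system_def]
  have lin: "bounded_linear complex_of_real" by (rule bounded_linear_of_real)
  show ?thesis
    unfolding sl_system_def
    using antideriv_linear[OF conjunct1[OF sys] lin] antideriv_linear[OF conjunct2[OF sys] lin]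
    by (simp add: scaleR_conv_of_real)
qed

text \<open>Bridge from the integral form to the almost-everywhere form. Off the zeros of
  \<open>p\<close>, where 1/p has the default value 0, the first equation can be solved for
  \<open>u1\<close>; off the zeros of \<open>r\<close>, the second can be divided by
  \<open>r\<close>.\<close>

lemma sl_system_imp_sl_solution:
  assumes sys: "sl_system (einterval a b) p q r s z u u1"
    and nz: "AE x\<in>einterval a b in lebesgue. r x > 0" "AE x\<in>einterval a b in lebesgue. p x \<noteq> 0"
  shows "sl_solution a b p q r s z u"
proof -
  define du where "du t = (1 / p t) *\<^sub>R u1 t - s t *\<^sub>R u t" for t
  define du1 where "du1 t = s t *\<^sub>R u1 t + q t *\<^sub>R u t - r t *\<^sub>R (z * u t)" for t
  have u: "antideriv (einterval a b) du u" and u1: "antideriv (einterval a b) du1 u1"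
    using sys unfolding sl_system_def du_def[abs_def] du1_def[abs_def] by blast+
  have d: "ae_deriv a b u du" "ae_deriv a b u1 du1"
    unfolding ae_deriv_def using u u1 by (auto intro: antideriv_AE_vector_derivative)
  have q1: "AE x\<in>einterval a b in lebesgue. u1 x = of_real (p x) * (du x + of_real (s x) * u x)"
    using nz(2) by eventually_elim (simp add: du_def scaleR_conv_of_real)
  have q2: "AE x\<in>einterval a b in lebesgue. z * u x = 1 / of_real (r x) *
                (- du1 x + of_real (s x) * u1 x + of_real (q x) * u x)"
    using nz(1) by eventually_elim (auto simp: du1_def scaleR_conv_of_real)
  have "quasi_deriv a b p s u u1"
    unfolding quasi_deriv_def using u u1 d q1 antideriv_imp_AC_loc by blast
  then show ?thesis
    unfolding sl_solution_def sl_domain_def has_tau_def using d(2) q2 by blast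
qed

text \<open>Lagrange's identity: in the product rule the terms with 1/p, s and q cancel, and only
  the difference of the spectral parameters survives.\<close>

lemma wronskian_antideriv:
  fixes z z' :: "'a::{real_normed_field, euclidean_space}"
  assumes "sl_system I p q r s z y y1" "sl_system I p q r s z' w w1" "open I"
  shows "antideriv I (\<lambda>t. r t *\<^sub>R ((z - z') * y t * w t)) (\<lambda>t. y t * w1 t - y1 t * w t)"
proof -
  note y = assms(1)[unfolded sl_system_def] and w = assms(2)[unfolded sl_system_def]
  show ?thesis
    by (rule antideriv_cong[OF antideriv_diff[OF
          antideriv_bilinear[OF bounded_bilinear_mult conjunct1[OF y] conjunct2[OF w] assms(3)]
          antideriv_bilinear[OF bounded_bilinear_mult conjunct2[OF y] conjunct1[OF w] assms(3)]]])
       (simp_all add: scaleR_conv_of_real algebra_simps)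
qed

lemma antideriv_zero_const:
  assumes "antideriv I f F" "\<And>t. t \<in> I \<Longrightarrow> f t = 0" "is_interval I" "x \<in> I" "y \<in> I"
  shows "F y = F x"
  using antideriv_norm_bound[OF assms(1) antideriv_const assms(3-5), of 0] assms(2) by simp

lemma wronskian_const:
  fixes z :: "'a::{real_normed_field, euclidean_space}"
  assumes "sl_system I p q r s z y y1" "sl_system I p q r s z w w1" "open I" "is_interval I"
    and "x \<in> I" "c \<in> I"
  shows "y x * w1 x - y1 x * w x = y c * w1 c - y1 c * w c"
  using antideriv_zero_const[OF wronskian_antideriv[OF assms(1-3)] _ assms(4,6,5)] by simp

text \<open>To the right N exp(-K) is nonincreasing, to the left N exp(K) is nondecreasing. Both
  directions are needed because the reference point is interior.\<close>

lemma gronwall: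
  fixes n N k K :: "real \<Rightarrow> real"
  assumes N: "antideriv I n N" and K: "antideriv I k K" and I: "open I" "is_interval I"
    and N0: "\<And>t. t \<in> I \<Longrightarrow> N t \<ge> 0"
    and b: "\<And>t. t \<in> I \<Longrightarrow> \<bar>n t\<bar> \<le> k t * N t" and xy: "x \<in> I" "y \<in> I"
  shows "N y \<le> N x * exp \<bar>K y - K x\<bar>"
proof -
  have cK: "continuous_on I K" using K I(1) by (rule antideriv_continuous_on)
  have e: "antideriv I (\<lambda>t. k t * (\<sigma> * exp (\<sigma> * K t))) (\<lambda>t. exp (\<sigma> * K t))" for \<sigma>
    by (rule antideriv_chain[OF K I(1), where \<phi> = "\<lambda>x. exp (\<sigma> * x)" and \<phi>' = "\<lambda>x. \<sigma> * exp (\<sigma> * x)"])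
       (auto intro!: derivative_eq_intros continuous_intros cK)
  note p = antideriv_bilinear[OF bounded_bilinear_mult N e I(1)]
  show ?thesis
  proof (cases "x \<le> y")
    case True
    have "N y * exp (- 1 * K y) - N x * exp (- 1 * K x) \<le> 0 - 0"
    proof (rule antideriv_mono[OF p antideriv_const I(2) xy True])
      fix t assume t: "t \<in> I"
      have "(n t - k t * N t) * exp (- K t) \<le> 0"
        using b[OF t] by (intro mult_nonpos_nonneg) auto
      then show "n t * exp (- 1 * K t) + N t * (k t * (- 1 * exp (- 1 * K t))) \<le> 0"
        by (simp add: algebra_simps)
    qed
    then have "N y \<le> N x * exp (K y - K x)"
      by (simp add: exp_minus exp_diff field_simps)
    also have "\<dots> \<le> N x * exp \<bar>K y - K x\<bar>"
      using N0[OF xy(1)] by (intro mult_left_mono) auto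
    finally show ?thesis .
  next
    case False
    have "0 - 0 \<le> N x * exp (1 * K x) - N y * exp (1 * K y)"
    proof (rule antideriv_mono[OF antideriv_const p I(2) xy(2,1)])
      fix t assume t: "t \<in> I"
      have "(n t + k t * N t) * exp (K t) \<ge> 0"
        using b[OF t] by (intro mult_nonneg_nonneg) auto
      then show "0 \<le> n t * exp (1 * K t) + N t * (k t * (1 * exp (1 * K t)))"
        by (simp add: algebra_simps)
    qed (use False in auto)
    then have "N y \<le> N x * exp (K x - K y)"
      by (simp add: exp_diff field_simps)
    also have "\<dots> \<le> N x * exp \<bar>K y - K x\<bar>"
      using N0[OF xy(1)] by (intro mult_left_mono) auto
    finally show ?thesis .
  qed
qed

section \<open>Square integrability near an endpoint\<close>

text \<open>Turns a bound uniform over compact subintervals into integrability up to the endpoints: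
  monotone convergence along an exhaustion handles the norm, which then dominates the truncations of
  \<open>f\<close>.\<close>

lemma loc_int_bounded_imp_absolutely_integrable:
  fixes f :: "real \<Rightarrow> 'a::euclidean_space"
  assumes "a < b" and f: "loc_int (einterval a b) f"
    and B: "\<And>x y. {x..y} \<subseteq> einterval a b \<Longrightarrow> integral {x..y} (\<lambda>t. norm (f t)) \<le> B"
  shows "f absolutely_integrable_on einterval a b"
proof -
  obtain l u where lu: "einterval a b = (\<Union>i. {l i..u i})" "incseq u" "decseq l"
    using einterval_Icc_approximation[OF \<open>a < b\<close>] by metis
  have sub: "{l i..u i} \<subseteq> einterval a b" for i unfolding lu(1) by blast
  have ev: "\<forall>\<^sub>F i in sequentially. x \<in> {l i..u i}" if x: "x \<in> einterval a b" for x
  proof -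
    obtain j where j: "x \<in> {l j..u j}" using x lu(1) by auto
    show ?thesis
      using j lu(2,3) by (intro eventually_sequentiallyI[of j])
        (auto intro: order_trans dest: incseqD decseqD)
  qed
  have mono: "{l i..u i} \<subseteq> {l (Suc i)..u (Suc i)}" for i
    using lu(2,3) by (auto simp: incseq_Suc_iff decseq_Suc_iff intro: order_trans)
  have abs: "(\<lambda>t. if t \<in> {l i..u i} then f t else 0) absolutely_integrable_on einterval a b" for i
  proof -
    have eq: "(\<lambda>t. indicator (einterval a b) t *\<^sub>R (if t \<in> {l i..u i} then f t else 0)) =
        (\<lambda>t. indicator {l i..u i} t *\<^sub>R f t)"
      using sub[of i] by (auto simp: fun_eq_iff indicator_def)
    show ?thesis
      using loc_int_D[OF f sub[of i]] unfolding set_integrable_def eq .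
  qed
  let ?g = "\<lambda>i t. if t \<in> {l i..u i} then norm (f t) else 0"
  have eqI: "?g i integrable_on einterval a b \<and> integral (einterval a b) (?g i) = integral {l i..u i} (\<lambda>t. norm (f t))" for i
    using loc_int_integrable[OF loc_int_norm[OF f] sub, of i] sub[of i]
    unfolding integrable_restrict_Int integral_restrict_Int by (simp add: Int_absorb2)
  have nf: "(\<lambda>t. norm (f t)) integrable_on einterval a b"
  proof (rule conjunct1[OF monotone_convergence_increasing[where f = ?g]])
    show "?g i integrable_on einterval a b" for i using eqI by blast
    show "?g i t \<le> ?g (Suc i) t" for i t using mono[of i] by auto
    show "(\<lambda>i. ?g i t) \<longlonglongrightarrow> norm (f t)" if "t \<in> einterval a b" for t
      by (rule tendsto_eventually, rule eventually_mono[OF ev[OF that]]) auto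
    show "bounded (range (\<lambda>i. integral (einterval a b) (?g i)))"
      using B[OF sub] integral_nonneg[OF loc_int_integrable[OF loc_int_norm[OF f] sub]] eqI
      by (intro boundedI[of _ B]) auto
  qed
  show ?thesis
  proof (rule dominated_convergence_absolutely_integrable[OF abs nf])
    show "(\<lambda>i. if t \<in> {l i..u i} then f t else 0) \<longlonglongrightarrow> f t" if "t \<in> einterval a b" for t
      by (rule tendsto_eventually, rule eventually_mono[OF ev[OF that]]) auto
  qed auto
qed

text \<open>Keeps the exponential factor of \<open>gronwall\<close> bounded up to the endpoints when
  the rate is integrable on all of \<open>J\<close>.\<close>

lemma antideriv_increment_le_integral:
  fixes k K :: "real \<Rightarrow> real"
  assumes K: "antideriv J k K" and k: "k absolutely_integrable_on J" "\<And>t. t \<in> J \<Longrightarrow> k t \<ge> 0"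
    and J: "is_interval J" "x \<in> J" "y \<in> J"
  shows "\<bar>K y - K x\<bar> \<le> integral J k"
proof -
  have *: "0 \<le> K v - K u \<and> K v - K u \<le> integral J k" if "u \<le> v" "u \<in> J" "v \<in> J" for u v
  proof -
    have sub: "{u..v} \<subseteq> J" using that J by (intro is_interval_Icc_subset)
    note i = antideriv_has_integral[OF K that(1) sub]
    have "0 \<le> K v - K u" using i k sub by (intro has_integral_nonneg[OF i]) auto
    moreover have "K v - K u \<le> integral J k"
      using k sub by (intro has_integral_subset_le[OF sub i])
        (auto intro: integrable_integral set_lebesgue_integral_eq_integral(1))
    ultimately show ?thesis by blast
  qed
  show ?thesis using *[of x y] *[of y x] J by (cases "x \<le> y") auto
qed

text \<open>
  Variation of constants: with \<open>\<alpha> = W(y, v)\<close> and \<open>\<beta> = W(u, y)\<close> one has \<open>y = \<alpha> u + \<beta> v\<close>, and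
  \<open>\<bar>\<alpha>\<bar>\<^sup>2 + \<bar>\<beta>\<bar>\<^sup>2\<close> obeys Gronwall's inequality with the integrable rate \<open>2 \<bar>\<mu> - z\<bar> r (\<bar>u\<bar>\<^sup>2 + \<bar>v\<bar>\<^sup>2)\<close>.
\<close>

lemma all_solutions_L2_transfer:
  fixes z \<mu> :: complex
  assumes "a < b" and J: "J = einterval a b"
    and r: "loc_int J r"
    and u: "sl_system J p q r s z u u1" and v: "sl_system J p q r s z v v1"
    and W: "\<And>t. t \<in> J \<Longrightarrow> u t * v1 t - u1 t * v t = 1"
    and L2: "(\<lambda>t. \<bar>r t\<bar> * ((cmod (u t))\<^sup>2 + (cmod (v t))\<^sup>2)) absolutely_integrable_on J"
    and y: "sl_system J p q r s \<mu> y y1"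
  shows "(\<lambda>t. \<bar>r t\<bar> * (cmod (y t))\<^sup>2) absolutely_integrable_on J"
proof -
  have oJ: "open J" and iJ: "is_interval J"
    unfolding J by (simp_all add: is_interval_einterval)
  obtain c where c: "c \<in> J"
    using \<open>a < b\<close> einterval_nonempty unfolding J by blast
  define U where "U t = (cmod (u t))\<^sup>2 + (cmod (v t))\<^sup>2" for t
  define C where "C = cmod (\<mu> - z)"
  define \<alpha> where "\<alpha> t = y t * v1 t - y1 t * v t" for t
  define \<beta> where "\<beta> t = u t * y1 t - u1 t * y t" for t
  define d\<alpha> where "d\<alpha> t = r t *\<^sub>R ((\<mu> - z) * y t * v t)" for t
  define d\<beta> where "d\<beta> t = r t *\<^sub>R ((z - \<mu>) * u t * y t)" for t
  have \<alpha>: "antideriv J d\<alpha> \<alpha>" and \<beta>: "antideriv J d\<beta> \<beta>"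
    unfolding \<alpha>_def[abs_def] \<beta>_def[abs_def] d\<alpha>_def[abs_def] d\<beta>_def[abs_def]
    using wronskian_antideriv[OF y v oJ] wronskian_antideriv[OF u y oJ] by blast+
  have yeq: "y t = \<alpha> t * u t + \<beta> t * v t" if "t \<in> J" for t
  proof -
    have "\<alpha> t * u t + \<beta> t * v t = y t * (u t * v1 t - u1 t * v t)"
      by (simp add: \<alpha>_def \<beta>_def algebra_simps)
    then show ?thesis using W[OF that] by simp
  qed
  \<comment> \<open>The squared moduli are written as real inner products so that the product rule
    for bilinear maps applies to the complex functions \<alpha> and \<beta>.\<close>
  define N where "N t = \<alpha> t \<bullet> \<alpha> t + \<beta> t \<bullet> \<beta> t" for t
  define n where "n t = (d\<alpha> t \<bullet> \<alpha> t + \<alpha> t \<bullet> d\<alpha> t) + (d\<beta> t \<bullet> \<beta> t + \<beta> t \<bullet> d\<beta> t)" for t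
  have N: "antideriv J n N"
    unfolding N_def[abs_def] n_def[abs_def]
    by (intro antideriv_add antideriv_bilinear[OF bounded_bilinear_inner] \<alpha> \<beta> oJ)
  have Neq: "N t = (cmod (\<alpha> t))\<^sup>2 + (cmod (\<beta> t))\<^sup>2" for t
    by (simp add: N_def dot_square_norm)
  define k where "k t = 2 * C * (\<bar>r t\<bar> * U t)" for t
  have Uc: "continuous_on J U"
    unfolding U_def using sl_system_continuous_on[OF u oJ] sl_system_continuous_on[OF v oJ]
    by (auto intro!: continuous_intros)
  have lrU: "loc_int J (\<lambda>t. \<bar>r t\<bar> * U t)"
    using loc_int_bilinear[OF bounded_bilinear_mult loc_int_norm[OF r] Uc] by simp
  have lk: "loc_int J k"
    unfolding k_def using lrU by (rule loc_int_cmult)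
  obtain K where K: "antideriv J k K"
    using antideriv_exists[OF lk iJ c] by blast
  have absrU: "(\<lambda>t. \<bar>r t\<bar> * U t) absolutely_integrable_on J" using L2 by (simp add: U_def)
  then have absk: "k absolutely_integrable_on J" unfolding k_def by simp
  have U0: "U t \<ge> 0" for t by (simp add: U_def)
  have k0: "k t \<ge> 0" for t by (simp add: k_def C_def U0)
  have cs: "(A * cmod x + B * cmod w)\<^sup>2 \<le> (A\<^sup>2 + B\<^sup>2) * ((cmod x)\<^sup>2 + (cmod w)\<^sup>2)" for A B x w
  proof -
    have "0 \<le> (A * cmod w - B * cmod x)\<^sup>2" by simp
    then show ?thesis by (simp add: power2_eq_square algebra_simps)
  qed
  have ybound: "(cmod (y t))\<^sup>2 \<le> N t * U t" if "t \<in> J" for t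
  proof -
    have "cmod (y t) \<le> cmod (\<alpha> t) * cmod (u t) + cmod (\<beta> t) * cmod (v t)"
      unfolding yeq[OF that] by (metis norm_mult norm_triangle_ineq)
    then have "(cmod (y t))\<^sup>2 \<le> (cmod (\<alpha> t) * cmod (u t) + cmod (\<beta> t) * cmod (v t))\<^sup>2"
      by (intro power_mono) auto
    also have "\<dots> \<le> N t * U t"
      unfolding Neq U_def by (rule cs)
    finally show ?thesis .
  qed
  \<comment> \<open>The factor 2 |y| (|\<alpha>| |v| + |\<beta>| |u|) is at most the sum of the two
    squares, and by Cauchy-Schwarz each square is at most N U.\<close>
  have rate: "\<bar>n t\<bar> \<le> k t * N t" if t: "t \<in> J" for t
  proof -
    let ?w = "cmod (\<alpha> t) * cmod (v t) + cmod (\<beta> t) * cmod (u t)"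
    have "\<bar>n t\<bar> \<le> 2 * \<bar>d\<alpha> t \<bullet> \<alpha> t\<bar> + 2 * \<bar>d\<beta> t \<bullet> \<beta> t\<bar>"
      unfolding n_def inner_commute[of "\<alpha> t"] inner_commute[of "\<beta> t"] by linarith
    also have "\<dots> \<le> 2 * (cmod (d\<alpha> t) * cmod (\<alpha> t)) + 2 * (cmod (d\<beta> t) * cmod (\<beta> t))"
      by (intro add_mono mult_left_mono Cauchy_Schwarz_ineq2) auto
    also have "\<dots> = C * \<bar>r t\<bar> * (2 * cmod (y t) * ?w)"
    proof -
      have "cmod (d\<alpha> t) = \<bar>r t\<bar> * (C * cmod (y t) * cmod (v t))"
        "cmod (d\<beta> t) = \<bar>r t\<bar> * (C * cmod (u t) * cmod (y t))"
        by (simp_all add: d\<alpha>_def d\<beta>_def C_def norm_mult norm_minus_commute)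
      then show ?thesis by (simp add: algebra_simps)
    qed
    also have "\<dots> \<le> C * \<bar>r t\<bar> * ((cmod (y t))\<^sup>2 + ?w\<^sup>2)"
      by (intro mult_left_mono sum_squares_bound) (simp add: C_def)
    also have "\<dots> \<le> C * \<bar>r t\<bar> * (N t * U t + N t * U t)"
    proof (intro mult_left_mono add_mono ybound[OF t])
      show "?w\<^sup>2 \<le> N t * U t"
        unfolding Neq U_def using cs[of "cmod (\<alpha> t)" "v t" "cmod (\<beta> t)" "u t"] by (simp add: add.commute)
    qed (simp add: C_def)
    finally show ?thesis by (simp add: k_def mult_ac)
  qed
  define M where "M = N c * exp (integral J k)"
  have N0: "N t \<ge> 0" for t by (simp add: Neq)
  have NM: "N t \<le> M" if "t \<in> J" for t
  proof -
    have "N t \<le> N c * exp \<bar>K t - K c\<bar>"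
      by (rule gronwall[OF N K oJ iJ N0 rate c that])
    also have "\<dots> \<le> M"
      unfolding M_def using antideriv_increment_le_integral[OF K absk k0 iJ c that] N0
      by (intro mult_left_mono) auto
    finally show ?thesis .
  qed
  have ly: "loc_int J (\<lambda>t. \<bar>r t\<bar> * (cmod (y t))\<^sup>2)"
    using loc_int_bilinear[OF bounded_bilinear_mult loc_int_norm[OF r], of "\<lambda>t. (cmod (y t))\<^sup>2"]
      sl_system_continuous_on[OF y oJ] by (simp add: continuous_on_norm continuous_on_power)
  have pt: "\<bar>r t\<bar> * (cmod (y t))\<^sup>2 \<le> M * (\<bar>r t\<bar> * U t)" if "t \<in> J" for t
  proof -
    have "(cmod (y t))\<^sup>2 \<le> M * U t"
      using ybound[OF that] mult_right_mono[OF NM[OF that] U0] by (rule order_trans)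
    from mult_left_mono[OF this, of "\<bar>r t\<bar>"] show ?thesis by (simp add: mult_ac)
  qed
  have M0: "M \<ge> 0" by (simp add: M_def N0)
  show ?thesis
    unfolding J
  proof (rule loc_int_bounded_imp_absolutely_integrable[OF \<open>a < b\<close> ly[unfolded J]])
    fix x x' assume "{x..x'} \<subseteq> einterval a b"
    then have sub: "{x..x'} \<subseteq> J" by (simp add: J)
    have "integral {x..x'} (\<lambda>t. norm (\<bar>r t\<bar> * (cmod (y t))\<^sup>2)) \<le> integral {x..x'} (\<lambda>t. M * (\<bar>r t\<bar> * U t))"
      using loc_int_integrable[OF ly sub] loc_int_integrable[OF loc_int_cmult[OF lrU] sub] pt sub
      by (intro integral_le) auto
    also have "\<dots> \<le> integral J (\<lambda>t. M * (\<bar>r t\<bar> * U t))"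
    proof (rule integral_subset_le[OF sub loc_int_integrable[OF loc_int_cmult[OF lrU] sub]])
      show "(\<lambda>t. M * (\<bar>r t\<bar> * U t)) integrable_on J"
        using absrU by (intro set_lebesgue_integral_eq_integral(1) set_integrable_mult_right)
    qed (use M0 U0 in auto)
    finally show "integral {x..x'} (\<lambda>t. norm (\<bar>r t\<bar> * (cmod (y t))\<^sup>2)) \<le> integral J (\<lambda>t. M * (\<bar>r t\<bar> * U t))" .
  qed
qed

text \<open>
  The integrand is the derivative of the Pruefer angle \<open>arctan (w / y)\<close>, which is bounded while \<open>y\<close>
  has no zero.
\<close>

lemma prufer_angle_integrable:
  fixes y w :: "real \<Rightarrow> real"
  assumes "a < b" and J: "J = einterval a b"
    and p: "loc_int J (\<lambda>t. 1 / p t)" "sign_definite_on p J"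
    and y: "sl_system J p q r s \<mu> y y1" and w: "sl_system J p q r s \<mu> w w1"
    and W: "\<And>t. t \<in> J \<Longrightarrow> y t * w1 t - y1 t * w t = 1"
    and nz: "\<And>t. t \<in> J \<Longrightarrow> y t \<noteq> 0"
  shows "(\<lambda>t. 1 / p t * inverse ((y t)\<^sup>2 + (w t)\<^sup>2)) absolutely_integrable_on J"
proof -
  have oJ: "open J" and iJ: "is_interval J"
    unfolding J by (simp_all add: is_interval_einterval)
  note cy = sl_system_continuous_on[OF y oJ] and cw = sl_system_continuous_on[OF w oJ]
  define f where "f t = 1 / p t * inverse ((y t)\<^sup>2 + (w t)\<^sup>2)" for t
  define dy where "dy t = (1 / p t) *\<^sub>R y1 t - s t *\<^sub>R y t" for t
  define dw where "dw t = (1 / p t) *\<^sub>R w1 t - s t *\<^sub>R w t" for t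
  have ady: "antideriv J dy y" and adw: "antideriv J dw w"
    using y w unfolding sl_system_def dy_def[abs_def] dw_def[abs_def] by blast+
  have inv: "antideriv J (\<lambda>t. dy t * - (inverse (y t) * inverse (y t))) (\<lambda>t. inverse (y t))"
    by (rule antideriv_chain[OF ady oJ, where \<phi> = inverse and \<phi>' = "\<lambda>x. - (inverse x * inverse x)"])
       (use nz in \<open>auto intro!: derivative_eq_intros continuous_intros cy\<close>)
  note quot = antideriv_bilinear[OF bounded_bilinear_mult adw inv oJ]
  have cq: "continuous_on J (\<lambda>t. w t * inverse (y t))"
    using nz by (auto intro!: continuous_intros cy cw)
  have pos: "0 < 1 + x\<^sup>2" for x :: real by (simp add: add_pos_nonneg)
  have ang: "antideriv J (\<lambda>t. (dw t * inverse (y t) + w t * (dy t * - (inverse (y t) * inverse (y t))))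
      * inverse (1 + (w t * inverse (y t))\<^sup>2)) (\<lambda>t. arctan (w t * inverse (y t)))"
    by (rule antideriv_chain[OF quot oJ, where \<phi> = arctan and \<phi>' = "\<lambda>x. inverse (1 + x\<^sup>2)"])
       (auto intro!: derivative_eq_intros continuous_intros cq simp: pos less_imp_neq[OF pos, symmetric])
  \<comment> \<open>In w' y - w y' the terms with \<open>s\<close> cancel, leaving the Wronskian 1
    divided by p; the factor y^2 then cancels against the derivative of
    \<open>arctan\<close>.\<close>
  have T: "antideriv J f (\<lambda>t. arctan (w t * inverse (y t)))"
  proof (rule antideriv_cong[OF ang])
    fix t assume t: "t \<in> J"
    have y0: "y t \<noteq> 0" using nz[OF t] .
    have s0: "(y t)\<^sup>2 + (w t)\<^sup>2 \<noteq> 0" using y0 by (simp add: sum_power2_eq_zero_iff)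
    have "dw t * inverse (y t) + w t * (dy t * - (inverse (y t) * inverse (y t)))
        = (dw t * y t - w t * dy t) / (y t)\<^sup>2"
      using y0 by (simp add: field_simps power2_eq_square)
    also have "dw t * y t - w t * dy t = 1 / p t * (y t * w1 t - y1 t * w t)"
      by (simp add: dw_def dy_def algebra_simps)
    also have "\<dots> = 1 / p t" using W[OF t] by simp
    finally have 1: "dw t * inverse (y t) + w t * (dy t * - (inverse (y t) * inverse (y t)))
        = 1 / p t / (y t)\<^sup>2" .
    have "1 + (w t * inverse (y t))\<^sup>2 = ((y t)\<^sup>2 + (w t)\<^sup>2) / (y t)\<^sup>2"
      using y0 by (simp add: field_simps)
    then have "inverse (1 + (w t * inverse (y t))\<^sup>2) = (y t)\<^sup>2 * inverse ((y t)\<^sup>2 + (w t)\<^sup>2)"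
      by (simp add: divide_inverse)
    then show "(dw t * inverse (y t) + w t * (dy t * - (inverse (y t) * inverse (y t))))
      * inverse (1 + (w t * inverse (y t))\<^sup>2) = f t"
      unfolding 1 f_def using y0 by simp
  qed simp
  have lf: "loc_int J f" using T by (rule antideriv_loc_int)
  \<comment> \<open>\<sigma> is the sign of \<open>p\<close>. Off a null set |f| = \<sigma> f, so
    the integral of |f| is \<sigma> times an increment of an arctangent, which is at most pi in
    modulus.\<close>
  obtain \<sigma> :: real where \<sigma>: "\<bar>\<sigma>\<bar> = 1" "AE t\<in>J in lebesgue. \<bar>f t\<bar> = \<sigma> * f t"
  proof -
    have "AE t\<in>J in lebesgue. \<bar>f t\<bar> = 1 * f t" if "AE t\<in>J in lebesgue. p t > 0"
      using that by eventually_elim (auto simp: f_def abs_mult)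
    moreover have "AE t\<in>J in lebesgue. \<bar>f t\<bar> = - 1 * f t" if "AE t\<in>J in lebesgue. p t < 0"
      using that by eventually_elim (auto simp: f_def abs_mult)
    ultimately show thesis
      using p(2) that[of 1] that[of "- 1"] unfolding sign_definite_on_def by fastforce
  qed
  then obtain Z where Z: "negligible Z" "\<And>t. t \<in> J - Z \<Longrightarrow> \<bar>f t\<bar> = \<sigma> * f t"
    unfolding eventually_ae_filter_negligible by blast
  have "f absolutely_integrable_on einterval a b"
  proof (rule loc_int_bounded_imp_absolutely_integrable[OF \<open>a < b\<close> lf[unfolded J]])
    fix x x' assume "{x..x'} \<subseteq> einterval a b"
    then have sub: "{x..x'} \<subseteq> J" by (simp add: J)
    show "integral {x..x'} (\<lambda>t. norm (f t)) \<le> pi"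
    proof (cases "x \<le> x'")
      case True
      have "((\<lambda>t. \<sigma> * f t) has_integral \<sigma> * (arctan (w x' * inverse (y x')) - arctan (w x * inverse (y x)))) {x..x'}"
        by (intro has_integral_mult_right antideriv_has_integral[OF T True sub])
      then have "((\<lambda>t. norm (f t)) has_integral \<sigma> * (arctan (w x' * inverse (y x')) - arctan (w x * inverse (y x)))) {x..x'}"
        by (rule has_integral_spike[OF Z(1), rotated]) (use Z(2) sub in auto)
      then have "integral {x..x'} (\<lambda>t. norm (f t)) = \<sigma> * (arctan (w x' * inverse (y x')) - arctan (w x * inverse (y x)))"
        by (rule integral_unique)
      also have "\<dots> \<le> \<bar>\<sigma>\<bar> * \<bar>arctan (w x' * inverse (y x')) - arctan (w x * inverse (y x))\<bar>"
        by (metis abs_ge_self abs_mult)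
      also have "\<dots> \<le> pi"
      proof -
        have "\<bar>arctan u - arctan v\<bar> \<le> pi" for u v
          using arctan_bounded[of u] arctan_bounded[of v] by (auto simp: abs_le_iff)
        then show ?thesis unfolding \<sigma>(1) by simp
      qed
      finally show ?thesis .
    qed simp
  qed
  then show ?thesis by (simp add: f_def[abs_def] J)
qed

section \<open>An integrable majorant of \<open>sqrt \<bar>r / p\<bar>\<close>\<close>

lemma nn_integral_finite_by_cover:
  fixes f :: "real \<Rightarrow> real"
  assumes "D \<subseteq> A \<union> B" and g: "g absolutely_integrable_on A" and h: "h absolutely_integrable_on B"
    and b: "\<And>t. t \<in> A \<Longrightarrow> f t \<le> g t" "\<And>t. t \<in> B \<Longrightarrow> f t \<le> h t"
    and nn: "\<And>t. g t \<ge> 0" "\<And>t. h t \<ge> 0"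
  shows "(\<integral>\<^sup>+t\<in>D. ennreal (f t) \<partial>lebesgue) < \<infinity>"
proof -
  \<comment> \<open>The two pieces may overlap: both majorants are nonnegative, so their sum still
    dominates there.\<close>
  let ?F = "\<lambda>t. indicator A t *\<^sub>R g t + indicator B t *\<^sub>R h t"
  have "integrable lebesgue ?F"
    using g h unfolding set_integrable_def by (rule Bochner_Integration.integrable_add)
  then have fin: "(\<integral>\<^sup>+t. ennreal (norm (?F t)) \<partial>lebesgue) < \<infinity>"
    by (simp add: integrable_iff_bounded)
  have "(\<integral>\<^sup>+t\<in>D. ennreal (f t) \<partial>lebesgue) \<le> (\<integral>\<^sup>+t. ennreal (norm (?F t)) \<partial>lebesgue)"
  proof (rule nn_integral_mono)
    fix t
    show "ennreal (f t) * indicator D t \<le> ennreal (norm (?F t))"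
    proof (cases "t \<in> D")
      case True
      then have "f t \<le> norm (?F t)"
        using assms(1) b[of t] nn[of t] by (cases "t \<in> A"; cases "t \<in> B") auto
      then show ?thesis using True by (simp add: ennreal_leI)
    qed simp
  qed
  then show ?thesis using fin by (rule le_less_trans)
qed

text \<open>Arithmetic-geometric mean of |r| \<rho> and 1/(|p| \<rho>), whose product does not
  depend on \<rho>. At p = 0 the convention for division makes the left side 0, so the bound is
  pointwise without exceptional set.\<close>

lemma sqrt_ratio_le:
  fixes r p \<rho> :: real
  assumes "\<rho> > 0"
  shows "sqrt \<bar>r / p\<bar> \<le> (\<bar>r\<bar> * \<rho> + \<bar>1 / p * inverse \<rho>\<bar>) / 2"
proof -
  have "\<bar>r / p\<bar> = (\<bar>r\<bar> * \<rho>) * \<bar>1 / p * inverse \<rho>\<bar>"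
    using assms by (simp add: abs_mult field_simps)
  then show ?thesis
    using assms by (simp only:) (rule arith_geo_mean_sqrt, auto)
qed

text \<open>\<open>r\<close> is positive only almost everywhere; with |r| the weight becomes
  nonnegative everywhere, as pointwise estimates require.\<close>

lemma weighted_L2_absolutely_integrable:
  assumes "weighted_L2 r J u"
  shows "(\<lambda>t. \<bar>r t\<bar> * (cmod (u t))\<^sup>2) absolutely_integrable_on J"
proof -
  have "(\<lambda>t. (cmod (u t))\<^sup>2 * r t) absolutely_integrable_on J"
    using assms unfolding weighted_L2_def by blast
  then have "(\<lambda>t. \<bar>(cmod (u t))\<^sup>2 * r t\<bar>) absolutely_integrable_on J"
    by (rule set_integrable_abs)
  moreover have "(\<lambda>t. \<bar>(cmod (u t))\<^sup>2 * r t\<bar>) = (\<lambda>t. \<bar>r t\<bar> * (cmod (u t))\<^sup>2)"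
    by (simp add: fun_eq_iff abs_mult)
  ultimately show ?thesis by metis
qed

text \<open>The core for either endpoint: \<open>J\<close> stands for (m, b) or (a, m). The initial
  point \<open>c\<close> may lie outside \<open>J\<close>, so the solutions live on the whole
  interval and are restricted to \<open>J\<close> only for the estimates.\<close>

lemma limit_circle_nonosc_sqrt_ratio_bound:
  fixes y y1 :: "real \<Rightarrow> real"
  assumes J: "J = einterval a' b'" "J \<subseteq> einterval a b" "a' < b'"
    and co: "sl_coefficients a b p q r s"
    and c: "c \<in> einterval a b" and sd: "sign_definite_on p J"
    and y: "sl_system (einterval a b) p q r s \<mu> y y1" "y c = 1" "y1 c = 0"
    and nz: "\<And>t. t \<in> J \<Longrightarrow> y t \<noteq> 0"
    and lc: "\<And>u. sl_solution a b p q r s z u \<Longrightarrow> weighted_L2 r J u"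
  shows "\<exists>g. g absolutely_integrable_on J \<and> (\<forall>t. g t \<ge> 0) \<and> (\<forall>t\<in>J. sqrt \<bar>r t / p t\<bar> \<le> g t)"
proof -
  let ?I = "einterval a b"
  have I: "open ?I" "is_interval ?I" "c \<in> ?I" using c by (simp_all add: is_interval_einterval)
  have co': "loc_int ?I (\<lambda>t. 1 / p t)" "loc_int ?I q" "loc_int ?I r" "loc_int ?I s"
    and ae: "AE x\<in>?I in lebesgue. r x > 0" "AE x\<in>?I in lebesgue. p x \<noteq> 0"
    using co by (simp_all add: sl_coefficients_def L1_loc_loc_int)
  obtain w w1 where w: "w c = 0" "w1 c = 1" "sl_system ?I p q r s \<mu> w w1"
    using sl_system_exists[OF I co'] by blast
  obtain u u1 where u: "u c = 1" "u1 c = 0" "sl_system ?I p q r s z u u1"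
    using sl_system_exists[OF I co'] by blast
  obtain v v1 where v: "v c = 0" "v1 c = 1" "sl_system ?I p q r s z v v1"
    using sl_system_exists[OF I co'] by blast
  \<comment> \<open>The initial data (1, 0) and (0, 1) at \<open>c\<close> give Wronskian 1 there,
    and it is constant for equal parameters; the same holds for \<open>y\<close> and
    \<open>w\<close>.\<close>
  have W: "u t * v1 t - u1 t * v t = 1" if "t \<in> J" for t
    using wronskian_const[OF u(3) v(3) I(1,2) _ I(3), of t] that J(2) u(1,2) v(1,2) by auto
  have W': "y t * w1 t - y1 t * w t = 1" if "t \<in> J" for t
    using wronskian_const[OF y(1) w(3) I(1,2) _ I(3), of t] that J(2) y(2,3) w(1,2) by auto
  have uv: "(\<lambda>t. \<bar>r t\<bar> * ((cmod (u t))\<^sup>2 + (cmod (v t))\<^sup>2)) absolutely_integrable_on J"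
    using set_integral_add(1)[OF weighted_L2_absolutely_integrable weighted_L2_absolutely_integrable, OF lc lc,
        OF sl_system_imp_sl_solution sl_system_imp_sl_solution, OF u(3) ae v(3) ae]
    by (simp add: distrib_left)
  have L2: "(\<lambda>t. \<bar>r t\<bar> * (f t)\<^sup>2) absolutely_integrable_on J"
    if "sl_system ?I p q r s \<mu> f f1" for f f1 :: "real \<Rightarrow> real"
    using all_solutions_L2_transfer[OF J(3,1) loc_int_subset[OF co'(3) J(2)]
        sl_system_subset[OF u(3) J(2)] sl_system_subset[OF v(3) J(2)] W uv
        sl_system_subset[OF sl_system_of_real[OF that] J(2)]]
    by simp
  have ang: "(\<lambda>t. 1 / p t * inverse ((y t)\<^sup>2 + (w t)\<^sup>2)) absolutely_integrable_on J"
    by (rule prufer_angle_integrable[OF J(3,1) loc_int_subset[OF co'(1) J(2)] sd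
        sl_system_subset[OF y(1) J(2)] sl_system_subset[OF w(3) J(2)] W' nz])
  define g where "g t = (\<bar>r t\<bar> * ((y t)\<^sup>2 + (w t)\<^sup>2) + \<bar>1 / p t * inverse ((y t)\<^sup>2 + (w t)\<^sup>2)\<bar>) / 2" for t
  have "g absolutely_integrable_on J"
    unfolding g_def
    using set_integral_add(1)[OF set_integral_add(1)[OF L2[OF y(1)] L2[OF w(3)]] set_integrable_abs[OF ang]]
    by (simp add: distrib_left)
  moreover have "g t \<ge> 0" for t by (simp add: g_def)
  moreover have "sqrt \<bar>r t / p t\<bar> \<le> g t" if "t \<in> J" for t
    unfolding g_def using nz[OF that] by (intro sqrt_ratio_le) (simp add: add_pos_nonneg)
  ultimately show ?thesis by blast
qed

text \<open>Away from the endpoints \<rho> = 1 is good enough, since \<open>r\<close> and 1/p are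
  locally integrable.\<close>

lemma sqrt_ratio_bound_on_Icc:
  assumes "sl_coefficients a b p q r s" and sub: "{x..y} \<subseteq> einterval a b"
  shows "\<exists>g. g absolutely_integrable_on {x..y} \<and> (\<forall>t. g t \<ge> 0) \<and> (\<forall>t\<in>{x..y}. sqrt \<bar>r t / p t\<bar> \<le> g t)"
proof -
  have "r absolutely_integrable_on {x..y}" "(\<lambda>t. 1 / p t) absolutely_integrable_on {x..y}"
    using assms by (simp_all add: sl_coefficients_def L1_loc_def)
  from set_integral_add(1)[OF this[THEN set_integrable_abs]]
  have "(\<lambda>t. (\<bar>r t\<bar> * 1 + \<bar>1 / p t * inverse 1\<bar>) / 2) absolutely_integrable_on {x..y}"
    by simp
  then show ?thesis
    using sqrt_ratio_le[of 1] by (intro exI[of _ "\<lambda>t. (\<bar>r t\<bar> * 1 + \<bar>1 / p t * inverse 1\<bar>) / 2"]) auto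
qed

text \<open>Divergence is assumed from a point \<open>d\<close> on, while the majorant is obtained
  only closer to the endpoint; the gap is a compact interval.\<close>

lemma sqrt_ratio_not_diverges_by_cover:
  assumes co: "sl_coefficients a b p q r s" and sub: "{x..y} \<subseteq> einterval a b"
    and g: "g absolutely_integrable_on J" "\<And>t. g t \<ge> 0" "\<And>t. t \<in> J \<Longrightarrow> sqrt \<bar>r t / p t\<bar> \<le> g t"
    and D: "D \<subseteq> {x..y} \<union> J"
  shows "\<not> sqrt_ratio_integral_diverges p r D"
proof -
  obtain h where h: "h absolutely_integrable_on {x..y}" "\<And>t. h t \<ge> 0"
      "\<And>t. t \<in> {x..y} \<Longrightarrow> sqrt \<bar>r t / p t\<bar> \<le> h t"
    using sqrt_ratio_bound_on_Icc[OF co sub] by blast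
  have "(\<integral>\<^sup>+t\<in>D. ennreal (sqrt \<bar>r t / p t\<bar>) \<partial>lebesgue) < \<infinity>"
    by (rule nn_integral_finite_by_cover[OF D h(1) g(1)]) (use h g in auto)
  then show ?thesis
    by (auto simp: sqrt_ratio_integral_diverges_def)
qed

text \<open>The value 1 at \<open>c\<close> makes the solution nontrivial, so non-oscillation
  applies to it; the same data later normalise the Wronskian.\<close>

lemma real_solution_from_initial_values:
  assumes co: "sl_coefficients a b p q r s" and c: "c \<in> einterval a b"
  shows "\<exists>y y1. sl_system (einterval a b) p q r s \<mu> y y1 \<and> y c = 1 \<and> y1 c = 0 \<and>
    nontrivial_real_solution a b p q r s \<mu> (\<lambda>t. of_real (y t))"
proof -
  let ?I = "einterval a b"
  have I: "open ?I" "is_interval ?I" "c \<in> ?I" using c by (simp_all add: is_interval_einterval)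
  have co': "loc_int ?I (\<lambda>t. 1 / p t)" "loc_int ?I q" "loc_int ?I r" "loc_int ?I s"
    and ae: "AE x\<in>?I in lebesgue. r x > 0" "AE x\<in>?I in lebesgue. p x \<noteq> 0"
    using co by (simp_all add: sl_coefficients_def L1_loc_loc_int)
  obtain y y1 where y: "y c = 1" "y1 c = 0" "sl_system ?I p q r s \<mu> y y1"
    using sl_system_exists[OF I co'] by blast
  have "sl_solution a b p q r s (of_real \<mu>) (\<lambda>t. of_real (y t))"
    using sl_system_imp_sl_solution[OF sl_system_of_real[OF y(3)] ae] .
  then have "nontrivial_real_solution a b p q r s \<mu> (\<lambda>t. of_real (y t))"
    unfolding nontrivial_real_solution_def using c y(1) by (auto intro!: bexI[of _ c])
  then show ?thesis using y by blast
qed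

section \<open>Cutting off near each endpoint\<close>

lemma sign_definite_on_subset:
  assumes "sign_definite_on p A" "B \<subseteq> A"
  shows "sign_definite_on p B"
  using assms(1) unfolding sign_definite_on_def
proof (elim disj_forward)
  assume "AE x\<in>A in lebesgue. p x > 0"
  then show "AE x\<in>B in lebesgue. p x > 0"
    by (rule eventually_mono) (use assms(2) in auto)
next
  assume "AE x\<in>A in lebesgue. p x < 0"
  then show "AE x\<in>B in lebesgue. p x < 0"
    by (rule eventually_mono) (use assms(2) in auto)
qed

lemma limit_point_criterion_right:
  assumes co: "sl_coefficients a b p q r s"
    and c: "c \<in> einterval a b" "sign_definite_on p (einterval (ereal c) b)"
    and osc: "\<not> oscillatory_at_right_end a b p q r s \<mu>"
    and d: "d \<in> einterval a b" "sqrt_ratio_integral_diverges p r (einterval (ereal d) b)"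
  shows "limit_point_at_right_end a b p q r s"
proof (rule ccontr)
  assume "\<not> limit_point_at_right_end a b p q r s"
  \<comment> \<open>The point \<open>e\<close> stays free because the cut-off \<open>m\<close> is
    chosen only after the zeros of \<open>y\<close> are known.\<close>
  then obtain z where z: "\<And>u e. sl_solution a b p q r s z u \<Longrightarrow> e \<in> einterval a b \<Longrightarrow>
      weighted_L2 r (einterval (ereal e) b) u"
    unfolding limit_point_at_right_end_def by blast
  obtain y y1 where y: "sl_system (einterval a b) p q r s \<mu> y y1" "y c = 1" "y1 c = 0"
      "nontrivial_real_solution a b p q r s \<mu> (\<lambda>t. of_real (y t))"
    using real_solution_from_initial_values[OF co c(1)] by blast
  obtain e where e: "e \<in> einterval a b" "finite {x \<in> einterval (ereal e) b. complex_of_real (y x) = 0}"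
    using osc y(4) unfolding oscillatory_at_right_end_def by blast
  \<comment> \<open>Beyond \<open>m\<close> the sign of \<open>p\<close> is fixed (m is at least c)
    and \<open>y\<close> has no zero, since a zero there would lie beyond \<open>e\<close> and hence
    be at most \<open>m\<close>. As a maximum of finitely many points below \<open>b\<close>,
    \<open>m\<close> is itself below \<open>b\<close>.\<close>
  define m where "m = Max ({c, d, e} \<union> {x \<in> einterval (ereal e) b. complex_of_real (y x) = 0})"
  have fin: "finite ({c, d, e} \<union> {x \<in> einterval (ereal e) b. complex_of_real (y x) = 0})"
    using e(2) by simp
  have ge: "x \<le> m" if "x \<in> {c, d, e} \<union> {x \<in> einterval (ereal e) b. complex_of_real (y x) = 0}" for x
    unfolding m_def using fin that by (rule Max_ge)
  have "m \<in> {c, d, e} \<union> {x \<in> einterval (ereal e) b. complex_of_real (y x) = 0}"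
    unfolding m_def by (rule Max_in[OF fin]) simp
  then have mb: "ereal m < b"
    using c(1) d(1) e(1) by (auto simp: einterval_def)
  have cm: "c \<le> m" "d \<le> m" "e \<le> m" using ge by auto
  then have mI: "m \<in> einterval a b"
    using mb c(1) less_le_trans[of a "ereal c" "ereal m"] by (simp add: einterval_def)
  let ?J = "einterval (ereal m) b"
  have sub: "?J \<subseteq> einterval a b"
    using mI by (auto simp: einterval_def intro: less_trans)
  have sd: "sign_definite_on p ?J"
    by (rule sign_definite_on_subset[OF c(2)])
       (use cm(1) in \<open>auto simp: einterval_def intro: le_less_trans\<close>)
  have nz: "y t \<noteq> 0" if "t \<in> ?J" for t
  proof
    assume "y t = 0"
    then have "t \<le> m" using that cm(3) by (intro ge) (auto simp: einterval_def)
    then show False using that by (auto simp: einterval_def)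
  qed
  have "\<exists>g. g absolutely_integrable_on ?J \<and> (\<forall>t. g t \<ge> 0) \<and> (\<forall>t\<in>?J. sqrt \<bar>r t / p t\<bar> \<le> g t)"
    by (rule limit_circle_nonosc_sqrt_ratio_bound[OF refl sub mb co c(1) sd y(1-3) nz z[OF _ mI]])
  then obtain g where g: "g absolutely_integrable_on ?J" "\<And>t. g t \<ge> 0" "\<And>t. t \<in> ?J \<Longrightarrow> sqrt \<bar>r t / p t\<bar> \<le> g t"
    by blast
  have "einterval (ereal d) b \<subseteq> {d..m} \<union> ?J"
    by (auto simp: einterval_def)
  moreover have "{d..m} \<subseteq> einterval a b"
    using is_interval_Icc_subset[OF is_interval_einterval d(1) mI] .
  ultimately show False
    using sqrt_ratio_not_diverges_by_cover[OF co _ g(1,2,3)] d(2) by metis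
qed

text \<open>Argued directly with a minimum in place of the maximum: since the core lemma treats any
  subinterval, no reflection of the coefficients is required.\<close>

lemma limit_point_criterion_left:
  assumes co: "sl_coefficients a b p q r s"
    and c: "c \<in> einterval a b" "sign_definite_on p (einterval a (ereal c))"
    and osc: "\<not> oscillatory_at_left_end a b p q r s \<mu>"
    and d: "d \<in> einterval a b" "sqrt_ratio_integral_diverges p r (einterval a (ereal d))"
  shows "limit_point_at_left_end a b p q r s"
proof (rule ccontr)
  assume "\<not> limit_point_at_left_end a b p q r s"
  then obtain z where z: "\<And>u e. sl_solution a b p q r s z u \<Longrightarrow> e \<in> einterval a b \<Longrightarrow>
      weighted_L2 r (einterval a (ereal e)) u"
    unfolding limit_point_at_left_end_def by blast
  obtain y y1 where y: "sl_system (einterval a b) p q r s \<mu> y y1" "y c = 1" "y1 c = 0"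
      "nontrivial_real_solution a b p q r s \<mu> (\<lambda>t. of_real (y t))"
    using real_solution_from_initial_values[OF co c(1)] by blast
  obtain e where e: "e \<in> einterval a b" "finite {x \<in> einterval a (ereal e). complex_of_real (y x) = 0}"
    using osc y(4) unfolding oscillatory_at_left_end_def by blast
  define m where "m = Min ({c, d, e} \<union> {x \<in> einterval a (ereal e). complex_of_real (y x) = 0})"
  have fin: "finite ({c, d, e} \<union> {x \<in> einterval a (ereal e). complex_of_real (y x) = 0})"
    using e(2) by simp
  have le: "m \<le> x" if "x \<in> {c, d, e} \<union> {x \<in> einterval a (ereal e). complex_of_real (y x) = 0}" for x
    unfolding m_def using fin that by (rule Min_le)
  have "m \<in> {c, d, e} \<union> {x \<in> einterval a (ereal e). complex_of_real (y x) = 0}"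
    unfolding m_def by (rule Min_in[OF fin]) simp
  then have am: "a < ereal m"
    using c(1) d(1) e(1) by (auto simp: einterval_def)
  have cm: "m \<le> c" "m \<le> d" "m \<le> e" using le by auto
  then have mI: "m \<in> einterval a b"
    using am c(1) le_less_trans[of "ereal m" "ereal c" b] by (simp add: einterval_def)
  let ?J = "einterval a (ereal m)"
  have sub: "?J \<subseteq> einterval a b"
    using mI less_trans[of _ "ereal m" b] by (auto simp: einterval_def)
  have sd: "sign_definite_on p ?J"
    by (rule sign_definite_on_subset[OF c(2)])
       (use cm(1) in \<open>auto simp: einterval_def intro: less_le_trans\<close>)
  have nz: "y t \<noteq> 0" if "t \<in> ?J" for t
  proof
    assume "y t = 0"
    then have "m \<le> t" using that cm(3) by (intro le) (auto simp: einterval_def)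
    then show False using that by (auto simp: einterval_def)
  qed
  have "\<exists>g. g absolutely_integrable_on ?J \<and> (\<forall>t. g t \<ge> 0) \<and> (\<forall>t\<in>?J. sqrt \<bar>r t / p t\<bar> \<le> g t)"
    by (rule limit_circle_nonosc_sqrt_ratio_bound[OF refl sub am co c(1) sd y(1-3) nz z[OF _ mI]])
  then obtain g where g: "g absolutely_integrable_on ?J" "\<And>t. g t \<ge> 0" "\<And>t. t \<in> ?J \<Longrightarrow> sqrt \<bar>r t / p t\<bar> \<le> g t"
    by blast
  have "einterval a (ereal d) \<subseteq> {m..d} \<union> ?J"
    by (auto simp: einterval_def)
  moreover have "{m..d} \<subseteq> einterval a b"
    using is_interval_Icc_subset[OF is_interval_einterval mI d(1)] .
  ultimately show False
    using sqrt_ratio_not_diverges_by_cover[OF co _ g(1,2,3)] d(2) by metis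
qed

theorem theorem11p7:
  fixes a b :: ereal and p q r s :: "real \<Rightarrow> real"
  assumes "a < b"
    and "sl_coefficients a b p q r s"
  shows
    "((\<exists>c\<in>einterval a b. sign_definite_on p (einterval (ereal c) b)) \<and>
      (\<exists>\<mu>::real. \<not> oscillatory_at_right_end a b p q r s \<mu>) \<and>
      (\<exists>d\<in>einterval a b. sqrt_ratio_integral_diverges p r (einterval (ereal d) b))
      \<longrightarrow> limit_point_at_right_end a b p q r s) \<and>
     ((\<exists>c\<in>einterval a b. sign_definite_on p (einterval a (ereal c))) \<and>
      (\<exists>\<mu>::real. \<not> oscillatory_at_left_end a b p q r s \<mu>) \<and>
      (\<exists>d\<in>einterval a b. sqrt_ratio_integral_diverges p r (einterval a (ereal d)))
      \<longrightarrow> limit_point_at_left_end a b p q r s)"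
proof (intro conjI impI; elim conjE bexE exE)
  fix c \<mu> d
  assume "c \<in> einterval a b" "sign_definite_on p (einterval (ereal c) b)"
    "\<not> oscillatory_at_right_end a b p q r s \<mu>"
    "d \<in> einterval a b" "sqrt_ratio_integral_diverges p r (einterval (ereal d) b)"
  then show "limit_point_at_right_end a b p q r s"
    by (rule limit_point_criterion_right[OF assms(2)])
next
  fix c \<mu> d
  assume "c \<in> einterval a b" "sign_definite_on p (einterval a (ereal c))"
    "\<not> oscillatory_at_left_end a b p q r s \<mu>"
    "d \<in> einterval a b" "sqrt_ratio_integral_diverges p r (einterval a (ereal d))"
  then show "limit_point_at_left_end a b p q r s"
    by (rule limit_point_criterion_left[OF assms(2)])
qed

end
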